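(* Let $p$ be a prime and let $G$ be a non-abelian finite $p$-group of order $p^n$ with $|\gamma_2(G)| = p^k$ and $d(G) = d$. Then \[|M(G)| \leq p^{\frac{1}{2}(d-1)(n+k-2)+1}.\]
   Context: $\gamma_2(G)=[G,G]$ is the commutator subgroup of $G$; $d(G)$ is the minimal number of generators of $G$; $M(G)$ is the Schur multiplier of $G$, i.e. $M(G)=H^2(G,\mathbb{C}^{\times})$ with trivial action (for finite $G$, isomorphic to $H_2(G,\mathbb{Z})$). The exponent of $p$ is a rational number, so the inequality is one between real numbers. *)

theory Defs
  imports Complex_Main "HOL-Algebra.Algebra"
begin

definition complex_units :: "complex monoid" where
  "complex_units = \<lparr>carrier = - {0}, monoid.mult = (*), one = 1\<rparr>"

text \<open>
  Group cohomology in degree 2 with coefficients in an abelian group \<open>A\<close> (written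
  multiplicatively) on which \<open>G\<close> acts trivially, via the inhomogeneous bar complex.
  Cochains are not assumed to be normalized.
\<close>

abbreviation cochains2 :: "('a, 'c) monoid_scheme \<Rightarrow> ('b, 'd) monoid_scheme \<Rightarrow> ('a \<times> 'a \<Rightarrow> 'b) monoid" where
  "cochains2 G A \<equiv> product_group (carrier G \<times> carrier G) (\<lambda>_. A)"

definition cocycles2 :: "('a, 'c) monoid_scheme \<Rightarrow> ('b, 'd) monoid_scheme \<Rightarrow> ('a \<times> 'a \<Rightarrow> 'b) set" where
  "cocycles2 G A = {f \<in> carrier (cochains2 G A).
     \<forall>x\<in>carrier G. \<forall>y\<in>carrier G. \<forall>z\<in>carrier G.
       f (y, z) \<otimes>\<^bsub>A\<^esub> f (x, y \<otimes>\<^bsub>G\<^esub> z) = f (x \<otimes>\<^bsub>G\<^esub> y, z) \<otimes>\<^bsub>A\<^esub> f (x, y)}"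

definition coboundaries2 :: "('a, 'c) monoid_scheme \<Rightarrow> ('b, 'd) monoid_scheme \<Rightarrow> ('a \<times> 'a \<Rightarrow> 'b) set" where
  "coboundaries2 G A =
     (\<lambda>g. \<lambda>(x, y)\<in>carrier G \<times> carrier G. g y \<otimes>\<^bsub>A\<^esub> inv\<^bsub>A\<^esub> g (x \<otimes>\<^bsub>G\<^esub> y) \<otimes>\<^bsub>A\<^esub> g x) ` (carrier G \<rightarrow> carrier A)"

definition cohomology2 ::
    "('a, 'c) monoid_scheme \<Rightarrow> ('b, 'd) monoid_scheme \<Rightarrow> ('a \<times> 'a \<Rightarrow> 'b) set monoid" where
  "cohomology2 G A = (cochains2 G A)\<lparr>carrier := cocycles2 G A\<rparr> Mod coboundaries2 G A"

definition schur_multiplier :: "('a, 'c) monoid_scheme \<Rightarrow> ('a \<times> 'a \<Rightarrow> complex) set monoid" where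
  "schur_multiplier G = cohomology2 G complex_units"

text \<open>Meaningful for finitely generated \<open>G\<close> only; otherwise the value is unspecified.\<close>

definition min_generators :: "('a, 'c) monoid_scheme \<Rightarrow> nat" where
  "min_generators G =
     (LEAST m. \<exists>S. S \<subseteq> carrier G \<and> finite S \<and> card S = m \<and> generate G S = carrier G)"

lemma comm_group_complex_units: "comm_group complex_units"
  by (rule comm_groupI) (auto simp: complex_units_def Bex_def intro: exI[where x = "inverse _"])

lemma comm_group_cochains2:
  assumes "comm_group A" shows "comm_group (cochains2 G A)"
proof -
  interpret A: comm_group A by fact
  interpret C: group "cochains2 G A" by simp
  show ?thesis
    by (rule C.group_comm_groupI) (auto simp: PiE_iff A.m_comm intro!: restrict_ext)
qed

lemma subgroup_cocycles2:
  assumes "group G" "comm_group A" shows "subgroup (cocycles2 G A) (cochains2 G A)"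
proof -
  interpret G: group G by fact
  interpret A: comm_group A by fact
  interpret C: comm_group "cochains2 G A" by (rule comm_group_cochains2) fact
  show ?thesis
  proof (rule C.subgroupI)
    show "cocycles2 G A \<subseteq> carrier (cochains2 G A)"
      by (auto simp: cocycles2_def)
    have "\<one>\<^bsub>cochains2 G A\<^esub> \<in> cocycles2 G A"
      by (auto simp: cocycles2_def)
    then show "cocycles2 G A \<noteq> {}" by blast
  next
    fix f assume f: "f \<in> cocycles2 G A"
    then have fc: "f \<in> (\<Pi>\<^sub>E i\<in>carrier G \<times> carrier G. carrier A)"
      by (auto simp: cocycles2_def)
    then have [simp]: "f (x, y) \<in> carrier A" if "x \<in> carrier G" "y \<in> carrier G" for x y
      using that by (auto simp: PiE_iff)
    have "inv\<^bsub>A\<^esub> f (y, z) \<otimes>\<^bsub>A\<^esub> inv\<^bsub>A\<^esub> f (x, y \<otimes>\<^bsub>G\<^esub> z) = inv\<^bsub>A\<^esub> f (x \<otimes>\<^bsub>G\<^esub> y, z) \<otimes>\<^bsub>A\<^esub> inv\<^bsub>A\<^esub> f (x, y)"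
      if "x \<in> carrier G" "y \<in> carrier G" "z \<in> carrier G" for x y z
      using f that by (simp add: A.inv_mult[symmetric] cocycles2_def)
    then show "inv\<^bsub>cochains2 G A\<^esub> f \<in> cocycles2 G A"
      using fc by (auto simp: cocycles2_def)
  next
    fix f g assume f: "f \<in> cocycles2 G A" and g: "g \<in> cocycles2 G A"
    then have [simp]: "f (x, y) \<in> carrier A" "g (x, y) \<in> carrier A"
      if "x \<in> carrier G" "y \<in> carrier G" for x y
      using that by (auto simp: cocycles2_def PiE_iff)
    have swap: "(a \<otimes>\<^bsub>A\<^esub> b) \<otimes>\<^bsub>A\<^esub> (c \<otimes>\<^bsub>A\<^esub> d) = (a \<otimes>\<^bsub>A\<^esub> c) \<otimes>\<^bsub>A\<^esub> (b \<otimes>\<^bsub>A\<^esub> d)"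
      if "a \<in> carrier A" "b \<in> carrier A" "c \<in> carrier A" "d \<in> carrier A" for a b c d
      using that by (simp add: A.m_ac)
    have eq: "(f (y, z) \<otimes>\<^bsub>A\<^esub> g (y, z)) \<otimes>\<^bsub>A\<^esub> (f (x, y \<otimes>\<^bsub>G\<^esub> z) \<otimes>\<^bsub>A\<^esub> g (x, y \<otimes>\<^bsub>G\<^esub> z)) =
        (f (x \<otimes>\<^bsub>G\<^esub> y, z) \<otimes>\<^bsub>A\<^esub> g (x \<otimes>\<^bsub>G\<^esub> y, z)) \<otimes>\<^bsub>A\<^esub> (f (x, y) \<otimes>\<^bsub>A\<^esub> g (x, y))"
      if xyz: "x \<in> carrier G" "y \<in> carrier G" "z \<in> carrier G" for x y z
    proof -
      have "(f (y, z) \<otimes>\<^bsub>A\<^esub> f (x, y \<otimes>\<^bsub>G\<^esub> z)) \<otimes>\<^bsub>A\<^esub> (g (y, z) \<otimes>\<^bsub>A\<^esub> g (x, y \<otimes>\<^bsub>G\<^esub> z)) =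
          (f (x \<otimes>\<^bsub>G\<^esub> y, z) \<otimes>\<^bsub>A\<^esub> f (x, y)) \<otimes>\<^bsub>A\<^esub> (g (x \<otimes>\<^bsub>G\<^esub> y, z) \<otimes>\<^bsub>A\<^esub> g (x, y))"
        using f g xyz by (simp add: cocycles2_def)
      with xyz show ?thesis
        by (subst (1 2) swap) simp_all
    qed
    show "f \<otimes>\<^bsub>cochains2 G A\<^esub> g \<in> cocycles2 G A"
      using f g by (auto simp: cocycles2_def eq)
  qed
qed

lemma coboundaries2_subset:
  assumes "group G" "comm_group A" shows "coboundaries2 G A \<subseteq> cocycles2 G A"
proof -
  interpret G: group G by fact
  interpret A: comm_group A by fact
  have "g z \<otimes>\<^bsub>A\<^esub> inv\<^bsub>A\<^esub> g (y \<otimes>\<^bsub>G\<^esub> z) \<otimes>\<^bsub>A\<^esub> g y \<otimes>\<^bsub>A\<^esub>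
        (g (y \<otimes>\<^bsub>G\<^esub> z) \<otimes>\<^bsub>A\<^esub> inv\<^bsub>A\<^esub> g (x \<otimes>\<^bsub>G\<^esub> (y \<otimes>\<^bsub>G\<^esub> z)) \<otimes>\<^bsub>A\<^esub> g x) =
        g z \<otimes>\<^bsub>A\<^esub> inv\<^bsub>A\<^esub> g (x \<otimes>\<^bsub>G\<^esub> y \<otimes>\<^bsub>G\<^esub> z) \<otimes>\<^bsub>A\<^esub> g (x \<otimes>\<^bsub>G\<^esub> y) \<otimes>\<^bsub>A\<^esub>
        (g y \<otimes>\<^bsub>A\<^esub> inv\<^bsub>A\<^esub> g (x \<otimes>\<^bsub>G\<^esub> y) \<otimes>\<^bsub>A\<^esub> g x)"
    if g: "g \<in> carrier G \<rightarrow> carrier A" and "x \<in> carrier G" "y \<in> carrier G" "z \<in> carrier G" for g x y z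
  proof -
    have [simp]: "g u \<in> carrier A" if "u \<in> carrier G" for u
      using g that by auto
    have cancel: "(a \<otimes>\<^bsub>A\<^esub> inv\<^bsub>A\<^esub> c \<otimes>\<^bsub>A\<^esub> b) \<otimes>\<^bsub>A\<^esub> (c \<otimes>\<^bsub>A\<^esub> d \<otimes>\<^bsub>A\<^esub> e) = a \<otimes>\<^bsub>A\<^esub> b \<otimes>\<^bsub>A\<^esub> d \<otimes>\<^bsub>A\<^esub> e"
      if "a \<in> carrier A" "b \<in> carrier A" "c \<in> carrier A" "d \<in> carrier A" "e \<in> carrier A" for a b c d e
    proof -
      have "(a \<otimes>\<^bsub>A\<^esub> inv\<^bsub>A\<^esub> c \<otimes>\<^bsub>A\<^esub> b) \<otimes>\<^bsub>A\<^esub> (c \<otimes>\<^bsub>A\<^esub> d \<otimes>\<^bsub>A\<^esub> e)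
          = (inv\<^bsub>A\<^esub> c \<otimes>\<^bsub>A\<^esub> c) \<otimes>\<^bsub>A\<^esub> (a \<otimes>\<^bsub>A\<^esub> b \<otimes>\<^bsub>A\<^esub> d \<otimes>\<^bsub>A\<^esub> e)"
        by (simp only: A.m_ac A.m_closed A.inv_closed that)
      also have "\<dots> = \<one>\<^bsub>A\<^esub> \<otimes>\<^bsub>A\<^esub> (a \<otimes>\<^bsub>A\<^esub> b \<otimes>\<^bsub>A\<^esub> d \<otimes>\<^bsub>A\<^esub> e)"
        by (simp only: A.l_inv that)
      finally show ?thesis by (simp only: A.l_one A.m_closed that)
    qed
    have cancel': "(a \<otimes>\<^bsub>A\<^esub> d \<otimes>\<^bsub>A\<^esub> c) \<otimes>\<^bsub>A\<^esub> (b \<otimes>\<^bsub>A\<^esub> inv\<^bsub>A\<^esub> c \<otimes>\<^bsub>A\<^esub> e) = a \<otimes>\<^bsub>A\<^esub> b \<otimes>\<^bsub>A\<^esub> d \<otimes>\<^bsub>A\<^esub> e"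
      if "a \<in> carrier A" "b \<in> carrier A" "c \<in> carrier A" "d \<in> carrier A" "e \<in> carrier A" for a b c d e
    proof -
      have "(a \<otimes>\<^bsub>A\<^esub> d \<otimes>\<^bsub>A\<^esub> c) \<otimes>\<^bsub>A\<^esub> (b \<otimes>\<^bsub>A\<^esub> inv\<^bsub>A\<^esub> c \<otimes>\<^bsub>A\<^esub> e)
          = (inv\<^bsub>A\<^esub> c \<otimes>\<^bsub>A\<^esub> c) \<otimes>\<^bsub>A\<^esub> (a \<otimes>\<^bsub>A\<^esub> b \<otimes>\<^bsub>A\<^esub> d \<otimes>\<^bsub>A\<^esub> e)"
        by (simp only: A.m_ac A.m_closed A.inv_closed that)
      also have "\<dots> = \<one>\<^bsub>A\<^esub> \<otimes>\<^bsub>A\<^esub> (a \<otimes>\<^bsub>A\<^esub> b \<otimes>\<^bsub>A\<^esub> d \<otimes>\<^bsub>A\<^esub> e)"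
        by (simp only: A.l_inv that)
      finally show ?thesis by (simp only: A.l_one A.m_closed that)
    qed
    show ?thesis
      using that(2-) by (simp add: cancel cancel' G.m_assoc)
  qed
  then show ?thesis
    by (auto simp: coboundaries2_def cocycles2_def Pi_iff split: if_splits)
qed

lemma subgroup_coboundaries2:
  assumes "group G" "comm_group A" shows "subgroup (coboundaries2 G A) (cochains2 G A)"
proof -
  interpret G: group G by fact
  interpret A: comm_group A by fact
  interpret C: comm_group "cochains2 G A" by (rule comm_group_cochains2) fact
  define D where "D = (\<lambda>g. \<lambda>(x, y)\<in>carrier G \<times> carrier G.
    g y \<otimes>\<^bsub>A\<^esub> inv\<^bsub>A\<^esub> g (x \<otimes>\<^bsub>G\<^esub> y) \<otimes>\<^bsub>A\<^esub> g x)"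
  have B: "coboundaries2 G A = D ` (carrier G \<rightarrow> carrier A)"
    by (simp add: coboundaries2_def D_def)
  have D_closed: "D g \<in> carrier (cochains2 G A)" if "g \<in> carrier G \<rightarrow> carrier A" for g
    using that by (auto simp: D_def Pi_iff)
  show ?thesis
  proof (rule C.subgroupI)
    show "coboundaries2 G A \<subseteq> carrier (cochains2 G A)"
      unfolding B using D_closed by (rule image_subsetI)
    have "(\<lambda>_. \<one>\<^bsub>A\<^esub>) \<in> carrier G \<rightarrow> carrier A" by simp
    then show "coboundaries2 G A \<noteq> {}" unfolding B by blast
  next
    fix f assume "f \<in> coboundaries2 G A"
    then obtain g where g: "g \<in> carrier G \<rightarrow> carrier A" "f = D g" unfolding B by blast
    have [simp]: "g u \<in> carrier A" if "u \<in> carrier G" for u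
      using g(1) that by blast
    have "inv\<^bsub>cochains2 G A\<^esub> f = D (\<lambda>x. inv\<^bsub>A\<^esub> g x)"
      using D_closed[OF g(1)] g(2)
      by (simp add: D_def) (auto simp: A.inv_mult intro!: restrict_ext)
    moreover have "(\<lambda>x. inv\<^bsub>A\<^esub> g x) \<in> carrier G \<rightarrow> carrier A" by simp
    ultimately show "inv\<^bsub>cochains2 G A\<^esub> f \<in> coboundaries2 G A" by (simp only: B imageI)
  next
    fix f f' assume "f \<in> coboundaries2 G A" "f' \<in> coboundaries2 G A"
    then obtain g h where gh: "g \<in> carrier G \<rightarrow> carrier A" "f = D g"
        "h \<in> carrier G \<rightarrow> carrier A" "f' = D h" unfolding B by blast
    have [simp]: "g u \<in> carrier A" "h u \<in> carrier A" if "u \<in> carrier G" for u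
      using gh(1,3) that by blast+
    have "f \<otimes>\<^bsub>cochains2 G A\<^esub> f' = D (\<lambda>x. g x \<otimes>\<^bsub>A\<^esub> h x)"
      unfolding gh by (auto simp: D_def A.inv_mult A.m_ac intro!: restrict_ext)
    moreover have "(\<lambda>x. g x \<otimes>\<^bsub>A\<^esub> h x) \<in> carrier G \<rightarrow> carrier A" by simp
    ultimately show "f \<otimes>\<^bsub>cochains2 G A\<^esub> f' \<in> coboundaries2 G A" by (simp only: B imageI)
  qed
qed

lemma comm_group_cohomology2:
  assumes "group G" "comm_group A" shows "comm_group (cohomology2 G A)"
proof -
  interpret C: comm_group "cochains2 G A" by (rule comm_group_cochains2) fact
  let ?Z = "(cochains2 G A)\<lparr>carrier := cocycles2 G A\<rparr>"
  have Z: "comm_group ?Z"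
  proof (rule group.group_comm_groupI)
    show "group ?Z"
      using subgroup_cocycles2[OF assms] by (rule C.subgroup_imp_group)
    show "f \<otimes>\<^bsub>?Z\<^esub> g = g \<otimes>\<^bsub>?Z\<^esub> f" if "f \<in> carrier ?Z" "g \<in> carrier ?Z" for f g
      using C.m_comm[of f g] that by (simp add: cocycles2_def)
  qed
  have "subgroup (coboundaries2 G A) ?Z"
    using assms C.subgroup_incl coboundaries2_subset subgroup_coboundaries2 subgroup_cocycles2 by blast
  then show ?thesis
    unfolding cohomology2_def using Z by (rule comm_group.abelian_FactGroup[rotated])
qed

end

(*
  A cocycle f of G defines a central extension E_f of G by the nonzero complex numbers.
  Let a be central in G, K the subgroup generated by a, and Q = G/K.  Commutators in E_f of lifts
  of x and of a give a character phi_f(x) = f(x,a)/f(a,x) of G.  If phi_f is trivial, then K lifts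
  to a central subgroup of E_f, because the nonzero complex numbers are divisible, and f is
  cohomologous to an inflation from Q.  Hence |M(G)| <= #{phi_f} * |M(Q)|, and if a lies in the
  commutator subgroup the transgression gains a factor |K|: |M(G)| * |K| <= #{phi_f} * |M(Q)|.

  There are three uses.
  (1) G abelian, a of maximal order p^m among d generators: #{phi_f} <= |G/K| by orthogonality and
      |G| <= p^(m d), so induction gives |M(G)| <= p^((d-1) n / 2).
  (2) |G'| = p and a = [x,y] /= 1: phi_f is determined by phi_f(x) and phi_f(y) (a form of the
      Hall-Witt identity), so |M(G)| <= p |M(G/G')|.
  (3) |G'| > p and a in G' central of order p: phi_f is determined by its values on d generators,
      so |M(G)| <= p^(d-1) |M(G/K)|.
*)
theory Submission
  imports Defs
begin

subsection \<open>Cocycles and cohomology classes\<close>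

text \<open>The shape of the exponent comes from the reduction. Factoring out a central subgroup of
  order p inside the commutator subgroup lowers n and k by one each, so the claimed exponent drops
  by exactly d-1; this is the price of use (3), namely p^d pairings against the factor p won by
  transgression. At k = 1 the exponent is (d-1)(n-1)/2 + 1: the abelian bound for G/G', of order
  p^(n-1), plus one. Counting pairings on generators there would cost d-1 again, too much once d >
  2. Hence use (2) takes a to be a single commutator, which brings the count down to p^2.

  The gain |K| is the size of the kernel of inflation from Q to G: each character of K yields a
  class of Q that dies in G, and different characters yield different classes because every
  character of G is trivial on K when K lies in G'.

  In use (1) the exponents balance exactly when n <= m d, hence the choice of a generator of maximal
  order. What is carried through the inductions is a generating set with at most d elements, which
  passes to quotients.\<close>

lemma mult_eq_mult_cong:
  fixes a b c d :: "'a :: comm_semiring_1"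
  assumes "a * b = c * d" "a' * b' = c' * d'"
  shows "(a * a') * (b * b') = (c * c') * (d * d')"
proof -
  have "(a * a') * (b * b') = (a * b) * (a' * b')" by (simp add: ac_simps)
  then show ?thesis by (simp add: assms ac_simps)
qed

text \<open>Curried, with plain complex values and arbitrary behaviour off the carrier: products and
  quotients of cocycles become pointwise field arithmetic, and extensionality enters only when
  \<open>schur_class\<close> passes to \<open>cochains2\<close>.\<close>

definition cocycle :: "('a, 'c) monoid_scheme \<Rightarrow> ('a \<Rightarrow> 'a \<Rightarrow> complex) \<Rightarrow> bool" where
  "cocycle G f \<longleftrightarrow>
     (\<forall>x\<in>carrier G. \<forall>y\<in>carrier G. f x y \<noteq> 0) \<and>
     (\<forall>x\<in>carrier G. \<forall>y\<in>carrier G. \<forall>z\<in>carrier G.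
        f y z * f x (y \<otimes>\<^bsub>G\<^esub> z) = f (x \<otimes>\<^bsub>G\<^esub> y) z * f x y)"

definition cohomologous ::
    "('a, 'c) monoid_scheme \<Rightarrow> ('a \<Rightarrow> 'a \<Rightarrow> complex) \<Rightarrow> ('a \<Rightarrow> 'a \<Rightarrow> complex) \<Rightarrow> bool" where
  "cohomologous G f f' \<longleftrightarrow> (\<exists>g. (\<forall>x\<in>carrier G. g x \<noteq> 0) \<and>
     (\<forall>x\<in>carrier G. \<forall>y\<in>carrier G. f x y * g (x \<otimes>\<^bsub>G\<^esub> y) = f' x y * (g x * g y)))"

definition schur_class ::
    "('a, 'c) monoid_scheme \<Rightarrow> ('a \<Rightarrow> 'a \<Rightarrow> complex) \<Rightarrow> ('a \<times> 'a \<Rightarrow> complex) set" where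
  "schur_class G f =
     coboundaries2 G complex_units #>\<^bsub>cochains2 G complex_units\<^esub>
       restrict (case_prod f) (carrier G \<times> carrier G)"

lemma cohomologousE:
  assumes "cohomologous G f f'"
  obtains g where "\<And>x. x \<in> carrier G \<Longrightarrow> g x \<noteq> 0"
    and "\<And>x y. x \<in> carrier G \<Longrightarrow> y \<in> carrier G \<Longrightarrow> f x y * g (x \<otimes>\<^bsub>G\<^esub> y) = f' x y * (g x * g y)"
  using assms unfolding cohomologous_def by blast

lemma cohomologousI:
  assumes "\<And>x. x \<in> carrier G \<Longrightarrow> g x \<noteq> 0"
    and "\<And>x y. x \<in> carrier G \<Longrightarrow> y \<in> carrier G \<Longrightarrow> f x y * g (x \<otimes>\<^bsub>G\<^esub> y) = f' x y * (g x * g y)"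
  shows "cohomologous G f f'"
  using assms unfolding cohomologous_def by blast

lemma cohomologous_sym:
  assumes "group G" "cohomologous G f f'" shows "cohomologous G f' f"
proof -
  interpret group G by fact
  from assms(2) obtain g where g: "\<And>x. x \<in> carrier G \<Longrightarrow> g x \<noteq> 0"
    "\<And>x y. x \<in> carrier G \<Longrightarrow> y \<in> carrier G \<Longrightarrow> f x y * g (x \<otimes>\<^bsub>G\<^esub> y) = f' x y * (g x * g y)"
    by (elim cohomologousE) blast
  show ?thesis
    using g by (intro cohomologousI[where g = "\<lambda>x. inverse (g x)"]) (auto simp: field_simps)
qed

lemma cohomologous_trans:
  assumes "cohomologous G f f'" "cohomologous G f' f''"
  shows "cohomologous G f f''"
proof -
  obtain g where g: "\<And>x. x \<in> carrier G \<Longrightarrow> g x \<noteq> 0"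
    "\<And>x y. x \<in> carrier G \<Longrightarrow> y \<in> carrier G \<Longrightarrow> f x y * g (x \<otimes>\<^bsub>G\<^esub> y) = f' x y * (g x * g y)"
    using assms(1) by (elim cohomologousE) blast
  obtain h where h: "\<And>x. x \<in> carrier G \<Longrightarrow> h x \<noteq> 0"
    "\<And>x y. x \<in> carrier G \<Longrightarrow> y \<in> carrier G \<Longrightarrow> f' x y * h (x \<otimes>\<^bsub>G\<^esub> y) = f'' x y * (h x * h y)"
    using assms(2) by (elim cohomologousE) blast
  have "f x y * (g (x \<otimes>\<^bsub>G\<^esub> y) * h (x \<otimes>\<^bsub>G\<^esub> y)) = f'' x y * ((g x * h x) * (g y * h y))"
    if xy: "x \<in> carrier G" "y \<in> carrier G" for x y
  proof -
    have "f x y * (g (x \<otimes>\<^bsub>G\<^esub> y) * h (x \<otimes>\<^bsub>G\<^esub> y)) = f' x y * h (x \<otimes>\<^bsub>G\<^esub> y) * (g x * g y)"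
      by (simp flip: mult.assoc add: g(2)[OF xy])
    also have "\<dots> = f'' x y * ((g x * h x) * (g y * h y))"
      by (simp add: h(2)[OF xy] ac_simps)
    finally show ?thesis .
  qed
  then show ?thesis
    using g(1) h(1) by (intro cohomologousI[where g = "\<lambda>x. g x * h x"]) auto
qed

lemma cohomologous_mult:
  assumes "cohomologous G f f'" "cohomologous G h h'"
  shows "cohomologous G (\<lambda>x y. f x y * h x y) (\<lambda>x y. f' x y * h' x y)"
proof -
  obtain g where g: "\<And>x. x \<in> carrier G \<Longrightarrow> g x \<noteq> 0"
    "\<And>x y. x \<in> carrier G \<Longrightarrow> y \<in> carrier G \<Longrightarrow> f x y * g (x \<otimes>\<^bsub>G\<^esub> y) = f' x y * (g x * g y)"
    using assms(1) by (elim cohomologousE) blast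
  obtain k where k: "\<And>x. x \<in> carrier G \<Longrightarrow> k x \<noteq> 0"
    "\<And>x y. x \<in> carrier G \<Longrightarrow> y \<in> carrier G \<Longrightarrow> h x y * k (x \<otimes>\<^bsub>G\<^esub> y) = h' x y * (k x * k y)"
    using assms(2) by (elim cohomologousE) blast
  have "f x y * h x y * (g (x \<otimes>\<^bsub>G\<^esub> y) * k (x \<otimes>\<^bsub>G\<^esub> y)) = f' x y * h' x y * ((g x * k x) * (g y * k y))"
    if xy: "x \<in> carrier G" "y \<in> carrier G" for x y
    using mult_eq_mult_cong[OF g(2)[OF xy] k(2)[OF xy]] by (simp add: ac_simps)
  then show ?thesis
    using g(1) k(1) by (intro cohomologousI[where g = "\<lambda>x. g x * k x"]) auto
qed

lemma cohomologous_refl: "cohomologous G f f"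
  by (rule cohomologousI[where g = "\<lambda>_. 1"]) auto

lemma cocycle_mult: "cocycle G f \<Longrightarrow> cocycle G g \<Longrightarrow> cocycle G (\<lambda>x y. f x y * g x y)"
  unfolding cocycle_def
proof safe
  fix x y z assume f: "\<forall>x\<in>carrier G. \<forall>y\<in>carrier G. \<forall>z\<in>carrier G. f y z * f x (y \<otimes>\<^bsub>G\<^esub> z) = f (x \<otimes>\<^bsub>G\<^esub> y) z * f x y"
    and g: "\<forall>x\<in>carrier G. \<forall>y\<in>carrier G. \<forall>z\<in>carrier G. g y z * g x (y \<otimes>\<^bsub>G\<^esub> z) = g (x \<otimes>\<^bsub>G\<^esub> y) z * g x y"
    and xyz: "x \<in> carrier G" "y \<in> carrier G" "z \<in> carrier G"
  have "f y z * f x (y \<otimes>\<^bsub>G\<^esub> z) = f (x \<otimes>\<^bsub>G\<^esub> y) z * f x y" "g y z * g x (y \<otimes>\<^bsub>G\<^esub> z) = g (x \<otimes>\<^bsub>G\<^esub> y) z * g x y"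
    using f g xyz by blast+
  then show "f y z * g y z * (f x (y \<otimes>\<^bsub>G\<^esub> z) * g x (y \<otimes>\<^bsub>G\<^esub> z)) = f (x \<otimes>\<^bsub>G\<^esub> y) z * g (x \<otimes>\<^bsub>G\<^esub> y) z * (f x y * g x y)"
    by (rule mult_eq_mult_cong)
qed auto

lemma cocycle_divide: 
  assumes "group G" "cocycle G f" "cocycle G g" shows "cocycle G (\<lambda>x y. f x y / g x y)"
  using assms by (auto simp: cocycle_def group.is_monoid monoid.m_closed)

lemma inv_complex_units: "x \<noteq> 0 \<Longrightarrow> inv\<^bsub>complex_units\<^esub> x = inverse x"
proof -
  interpret comm_group complex_units by (rule comm_group_complex_units)
  show "x \<noteq> 0 \<Longrightarrow> inv\<^bsub>complex_units\<^esub> x = inverse x"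
    by (rule inv_equality) (auto simp: complex_units_def)
qed

lemma restrict_mem_cocycles2:
  assumes "group G"
  shows "restrict (case_prod f) (carrier G \<times> carrier G) \<in> cocycles2 G complex_units \<longleftrightarrow> cocycle G f"
proof -
  interpret group G by fact
  have "(\<forall>x\<in>carrier G. \<forall>y\<in>carrier G. f x y \<noteq> 0) \<longleftrightarrow>
    restrict (case_prod f) (carrier G \<times> carrier G) \<in> carrier (cochains2 G complex_units)"
    by (auto simp: complex_units_def Pi_iff)
  then show ?thesis by (simp add: cocycles2_def cocycle_def) (simp add: complex_units_def)
qed

text \<open>Together with \<open>schur_class_eq_iff\<close> this is the interface to the quotient
  group: all later counting works with representing cocycles modulo
  \<open>cohomologous\<close>.\<close>

lemma carrier_schur_multiplier:
  assumes "group G"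
  shows "carrier (schur_multiplier G) = schur_class G ` {f. cocycle G f}"
proof -
  interpret group G by fact
  let ?R = "\<lambda>f. restrict (case_prod f) (carrier G \<times> carrier G)"
  let ?C = "cochains2 G complex_units" and ?B = "coboundaries2 G complex_units"
  have R: "f = ?R (curry f)" if "f \<in> cocycles2 G complex_units" for f
    using that by (auto simp: cocycles2_def PiE_def extensional_def fun_eq_iff)
  have "cocycles2 G complex_units = ?R ` {f. cocycle G f}"
  proof (intro equalityI subsetI)
    fix f assume *: "f \<in> cocycles2 G complex_units"
    then have "cocycle G (curry f)" using R[OF *] restrict_mem_cocycles2[OF assms, of "curry f"] by metis
    then show "f \<in> ?R ` {f. cocycle G f}" using R[OF *] by blast
  qed (use restrict_mem_cocycles2[OF assms] in blast)
  moreover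
  have "carrier (schur_multiplier G) = (\<lambda>f. ?B #>\<^bsub>?C\<^esub> f) ` cocycles2 G complex_units"
    by (simp add: schur_multiplier_def cohomology2_def carrier_FactGroup r_coset_def)
  ultimately show ?thesis
    by (simp add: schur_class_def image_image)
qed

lemma schur_class_eq_iff:
  assumes "group G" "cocycle G f" "cocycle G f'"
  shows "schur_class G f = schur_class G f' \<longleftrightarrow> cohomologous G f f'"
proof -
  interpret group G by fact
  let ?R = "\<lambda>f. restrict (case_prod f) (carrier G \<times> carrier G)"
  let ?C = "cochains2 G complex_units" and ?B = "coboundaries2 G complex_units"
  interpret C: comm_group ?C by (rule comm_group_cochains2[OF comm_group_complex_units])
  interpret B: subgroup ?B ?C by (rule subgroup_coboundaries2[OF assms(1) comm_group_complex_units])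
  have car: "?R f \<in> carrier ?C" "?R f' \<in> carrier ?C"
    using assms restrict_mem_cocycles2[OF assms(1)] unfolding cocycles2_def by blast+
  have B: "?B #>\<^bsub>?C\<^esub> ?R f = ?B #>\<^bsub>?C\<^esub> ?R f' \<longleftrightarrow> ?R f \<in> ?B #>\<^bsub>?C\<^esub> ?R f'"
    using car C.repr_independence[OF _ car(2) B.subgroup_axioms] C.rcos_self[OF car(1) B.subgroup_axioms] by metis
  have D: "b \<in> ?B \<longleftrightarrow> (\<exists>g \<in> carrier G \<rightarrow> - {0}. b = (\<lambda>(x, y)\<in>carrier G \<times> carrier G. g y * inverse (g (x \<otimes>\<^bsub>G\<^esub> y)) * g x))" for b
    unfolding coboundaries2_def image_iff
    by (intro bex_cong) (auto simp: complex_units_def inv_complex_units[unfolded complex_units_def] fun_eq_iff Pi_iff)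
  show ?thesis
  proof
    assume "schur_class G f = schur_class G f'"
    then have "?R f \<in> ?B #>\<^bsub>?C\<^esub> ?R f'" using B by (simp add: schur_class_def)
    then obtain b where b: "b \<in> ?B" "?R f = b \<otimes>\<^bsub>?C\<^esub> ?R f'" by (auto simp: r_coset_def)
    then obtain g where g: "g \<in> carrier G \<rightarrow> - {0}" "b = (\<lambda>(x, y)\<in>carrier G \<times> carrier G. g y * inverse (g (x \<otimes>\<^bsub>G\<^esub> y)) * g x)"
      using D by blast
    have "f x y * g (x \<otimes>\<^bsub>G\<^esub> y) = f' x y * (g x * g y)" if "x \<in> carrier G" "y \<in> carrier G" for x y
    proof -
      have "?R f (x, y) = (b \<otimes>\<^bsub>?C\<^esub> ?R f') (x, y)" using b by simp
      then have "f x y = g y * inverse (g (x \<otimes>\<^bsub>G\<^esub> y)) * g x * f' x y"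
        using that g(2) by (simp add: complex_units_def)
      moreover have "g (x \<otimes>\<^bsub>G\<^esub> y) \<noteq> 0" using g(1) that by (auto simp: Pi_iff)
      ultimately show ?thesis by simp
    qed
    then show "cohomologous G f f'" using g(1) by (intro cohomologousI[where g = g]) (auto simp: Pi_iff)
  next
    assume "cohomologous G f f'"
    then obtain g where g: "\<And>x. x \<in> carrier G \<Longrightarrow> g x \<noteq> 0"
      "\<And>x y. x \<in> carrier G \<Longrightarrow> y \<in> carrier G \<Longrightarrow> f x y * g (x \<otimes>\<^bsub>G\<^esub> y) = f' x y * (g x * g y)"
      by (elim cohomologousE) blast
    define b where "b = (\<lambda>(x, y)\<in>carrier G \<times> carrier G. g y * inverse (g (x \<otimes>\<^bsub>G\<^esub> y)) * g x)"
    have "b \<in> ?B" using D[of b] g(1) b_def by (auto simp: Pi_iff)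
    moreover have "?R f = b \<otimes>\<^bsub>?C\<^esub> ?R f'"
    proof -
      have "f x y = g y * inverse (g (x \<otimes>\<^bsub>G\<^esub> y)) * g x * f' x y"
        if "x \<in> carrier G" "y \<in> carrier G" for x y
        using g(2)[OF that] g(1)[OF m_closed[OF that]] by (simp add: field_simps)
      then show ?thesis
        by (auto simp: b_def complex_units_def fun_eq_iff)
    qed
    ultimately have "?R f \<in> ?B #>\<^bsub>?C\<^esub> ?R f'" unfolding r_coset_def by blast
    then show "schur_class G f = schur_class G f'" using B by (simp add: schur_class_def)
  qed
qed

subsection \<open>Central extensions and the commutator pairing\<close>

lemma cocycle_nonzero: "cocycle G f \<Longrightarrow> x \<in> carrier G \<Longrightarrow> y \<in> carrier G \<Longrightarrow> f x y \<noteq> 0"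
  by (auto simp: cocycle_def)

lemma cocycle_eq:
  "cocycle G f \<Longrightarrow> x \<in> carrier G \<Longrightarrow> y \<in> carrier G \<Longrightarrow> z \<in> carrier G \<Longrightarrow>
    f y z * f x (y \<otimes>\<^bsub>G\<^esub> z) = f (x \<otimes>\<^bsub>G\<^esub> y) z * f x y"
  by (auto simp: cocycle_def)

lemma cocycle_one:
  assumes "group G" "cocycle G f" "x \<in> carrier G"
  shows "f x \<one>\<^bsub>G\<^esub> = f \<one>\<^bsub>G\<^esub> \<one>\<^bsub>G\<^esub>" "f \<one>\<^bsub>G\<^esub> x = f \<one>\<^bsub>G\<^esub> \<one>\<^bsub>G\<^esub>"
proof -
  interpret group G by fact
  show "f x \<one>\<^bsub>G\<^esub> = f \<one>\<^bsub>G\<^esub> \<one>\<^bsub>G\<^esub>"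
    using cocycle_eq[OF assms(2,3), of "\<one>\<^bsub>G\<^esub>" "\<one>\<^bsub>G\<^esub>"] cocycle_nonzero[OF assms(2,3), of "\<one>\<^bsub>G\<^esub>"] assms(3) by simp
  show "f \<one>\<^bsub>G\<^esub> x = f \<one>\<^bsub>G\<^esub> \<one>\<^bsub>G\<^esub>"
    using cocycle_eq[OF assms(2), of "\<one>\<^bsub>G\<^esub>" "\<one>\<^bsub>G\<^esub>" x] cocycle_nonzero[OF assms(2) _ assms(3), of "\<one>\<^bsub>G\<^esub>"] assms(3) by simp
qed

text \<open>The twisted function is the factor set of the extension by \<open>f\<close> with respect
  to the section sending x to (g x, x). It is used both to change sections and, with
  \<open>f\<close> constantly 1, to form coboundaries.\<close>

lemma cocycle_twist:
  assumes "group G" "cocycle G f" "\<And>x. x \<in> carrier G \<Longrightarrow> g x \<noteq> 0"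
  shows "cocycle G (\<lambda>x y. f x y * g x * g y / g (x \<otimes>\<^bsub>G\<^esub> y))"
proof -
  interpret group G by fact
  have "f y z * g y * g z / g (y \<otimes>\<^bsub>G\<^esub> z) * (f x (y \<otimes>\<^bsub>G\<^esub> z) * g x * g (y \<otimes>\<^bsub>G\<^esub> z) / g (x \<otimes>\<^bsub>G\<^esub> (y \<otimes>\<^bsub>G\<^esub> z))) =
    f (x \<otimes>\<^bsub>G\<^esub> y) z * g (x \<otimes>\<^bsub>G\<^esub> y) * g z / g (x \<otimes>\<^bsub>G\<^esub> y \<otimes>\<^bsub>G\<^esub> z) * (f x y * g x * g y / g (x \<otimes>\<^bsub>G\<^esub> y))"
    if xyz: "x \<in> carrier G" "y \<in> carrier G" "z \<in> carrier G" for x y z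
  proof -
    have "f y z * g y * g z / g (y \<otimes>\<^bsub>G\<^esub> z) * (f x (y \<otimes>\<^bsub>G\<^esub> z) * g x * g (y \<otimes>\<^bsub>G\<^esub> z) / g (x \<otimes>\<^bsub>G\<^esub> (y \<otimes>\<^bsub>G\<^esub> z))) =
      (f y z * f x (y \<otimes>\<^bsub>G\<^esub> z)) * (g x * g y * g z / g (x \<otimes>\<^bsub>G\<^esub> y \<otimes>\<^bsub>G\<^esub> z))"
      using xyz assms(3)[of "y \<otimes>\<^bsub>G\<^esub> z"] by (simp add: m_assoc)
    also have "\<dots> = (f (x \<otimes>\<^bsub>G\<^esub> y) z * f x y) * (g x * g y * g z / g (x \<otimes>\<^bsub>G\<^esub> y \<otimes>\<^bsub>G\<^esub> z))"
      using cocycle_eq[OF assms(2)] xyz by simp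
    also have "\<dots> = f (x \<otimes>\<^bsub>G\<^esub> y) z * g (x \<otimes>\<^bsub>G\<^esub> y) * g z / g (x \<otimes>\<^bsub>G\<^esub> y \<otimes>\<^bsub>G\<^esub> z) * (f x y * g x * g y / g (x \<otimes>\<^bsub>G\<^esub> y))"
      using xyz assms(3)[of "x \<otimes>\<^bsub>G\<^esub> y"] by simp
    finally show ?thesis .
  qed
  then show ?thesis
    using cocycle_nonzero[OF assms(2)] assms(3) by (simp add: cocycle_def)
qed

section \<open>The commutator pairing and the central extension of a cocycle\<close>

definition commutator_pairing :: "('a \<Rightarrow> 'a \<Rightarrow> complex) \<Rightarrow> 'a \<Rightarrow> 'a \<Rightarrow> complex" where
  "commutator_pairing f x y = f x y / f y x"

text \<open>The cocycle identity at (x, y, c), (c, x, y) and (x, c, y) gives three equations from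
  which the mixed values cancel. Only \<open>c\<close> has to commute with the other two elements,
  so for central \<open>c\<close> this yields a character of a non-abelian group.\<close>

lemma commutator_pairing_mult:
  assumes "group G" "cocycle G f" "x \<in> carrier G" "y \<in> carrier G" "c \<in> carrier G"
    and "c \<otimes>\<^bsub>G\<^esub> x = x \<otimes>\<^bsub>G\<^esub> c" "c \<otimes>\<^bsub>G\<^esub> y = y \<otimes>\<^bsub>G\<^esub> c"
  shows "commutator_pairing f (x \<otimes>\<^bsub>G\<^esub> y) c = commutator_pairing f x c * commutator_pairing f y c"
proof -
  interpret group G by fact
  note nz = cocycle_nonzero[OF assms(2)]
  have 1: "f y c * f x (y \<otimes>\<^bsub>G\<^esub> c) = f (x \<otimes>\<^bsub>G\<^esub> y) c * f x y"
    and 2: "f x y * f c (x \<otimes>\<^bsub>G\<^esub> y) = f (x \<otimes>\<^bsub>G\<^esub> c) y * f c x"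
    and 3: "f c y * f x (y \<otimes>\<^bsub>G\<^esub> c) = f (x \<otimes>\<^bsub>G\<^esub> c) y * f x c"
    using cocycle_eq[OF assms(2), of x y c] cocycle_eq[OF assms(2), of c x y]
      cocycle_eq[OF assms(2), of x c y] assms(3-) by simp_all
  have *: "A / B = x' / c1 * (y' / c2)"
    if "y' * P = A * Q" "Q * B = R * c1" "c2 * P = R * x'" "B \<noteq> 0" "c1 \<noteq> 0" "c2 \<noteq> 0" "Q \<noteq> 0" "P \<noteq> 0" "R \<noteq> 0"
    for A B Q P R x' y' c1 c2 :: complex
  proof -
    have "A = y' * P / Q" "B = R * c1 / Q" "P = R * x' / c2"
      using that by (simp_all add: field_simps)
    then have "A / B = (y' * (R * x' / c2) / Q) / (R * c1 / Q)" by simp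
    also have "\<dots> = x' / c1 * (y' / c2)" using that by (simp add: field_simps)
    finally show ?thesis .
  qed
  show ?thesis
    unfolding commutator_pairing_def
    by (rule *[OF 1 2 3]) (use nz assms(3-5) in auto)
qed

lemma commutator_pairing_one:
  assumes "group G" "cocycle G f" "x \<in> carrier G"
  shows "commutator_pairing f \<one>\<^bsub>G\<^esub> x = 1"
  using cocycle_one[OF assms] cocycle_nonzero[OF assms(2), of "\<one>\<^bsub>G\<^esub>" "\<one>\<^bsub>G\<^esub>"] assms(1)
  by (simp add: commutator_pairing_def group.is_monoid)

lemma commutator_pairing_pow:
  assumes "group G" "cocycle G f" "x \<in> carrier G" "c \<in> carrier G" "c \<otimes>\<^bsub>G\<^esub> x = x \<otimes>\<^bsub>G\<^esub> c"
  shows "commutator_pairing f (x [^]\<^bsub>G\<^esub> (n::nat)) c = commutator_pairing f x c ^ n"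
proof -
  interpret group G by fact
  have comm: "c \<otimes>\<^bsub>G\<^esub> x [^]\<^bsub>G\<^esub> (i::nat) = x [^]\<^bsub>G\<^esub> i \<otimes>\<^bsub>G\<^esub> c" for i
    using group_commutes_pow[of x c i] assms by simp
  show ?thesis
    by (induction n)
      (simp_all add: commutator_pairing_one commutator_pairing_mult[OF assms(1,2)] comm assms)
qed

lemma commutator_pairing_sym: "commutator_pairing f y x = inverse (commutator_pairing f x y)"
  by (simp add: commutator_pairing_def)

text \<open>Multiplicativity holds in the first argument; swapping the arguments inverts the pairing
  and moves the order of \<open>c\<close> into play. Thus every pairing with a fixed central
  \<open>a\<close> takes values in the roots of unity of order dividing \<open>ord a\<close>, which
  makes the pairings countable.\<close>

lemma commutator_pairing_pow_ord:
  assumes "group G" "cocycle G f" "x \<in> carrier G" "c \<in> carrier G" "c \<otimes>\<^bsub>G\<^esub> x = x \<otimes>\<^bsub>G\<^esub> c"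
  shows "commutator_pairing f x c ^ group.ord G c = 1"
proof -
  have "commutator_pairing f c x ^ group.ord G c = 1"
    using commutator_pairing_pow[OF assms(1,2,4,3) assms(5)[symmetric], of "group.ord G c"]
      commutator_pairing_one[OF assms(1-3)] assms(1,4) by (simp add: group.pow_ord_eq_1)
  then show ?thesis
    by (subst commutator_pairing_sym) (simp add: power_inverse)
qed

text \<open>The central extension with factor set \<open>f\<close>. Since \<open>f 1 1\<close> need
  not be 1, the identity has its inverse as scalar component.\<close>

definition ext_group :: "('a, 'c) monoid_scheme \<Rightarrow> ('a \<Rightarrow> 'a \<Rightarrow> complex) \<Rightarrow> (complex \<times> 'a) monoid" where
  "ext_group G f = \<lparr>carrier = (- {0}) \<times> carrier G,
     monoid.mult = (\<lambda>(\<alpha>, x) (\<beta>, y). (\<alpha> * \<beta> * f x y, x \<otimes>\<^bsub>G\<^esub> y)),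
     one = (inverse (f \<one>\<^bsub>G\<^esub> \<one>\<^bsub>G\<^esub>), \<one>\<^bsub>G\<^esub>)\<rparr>"

lemma ext_group_simps [simp]:
  "(\<alpha>, x) \<in> carrier (ext_group G f) \<longleftrightarrow> \<alpha> \<noteq> 0 \<and> x \<in> carrier G"
  "(\<alpha>, x) \<otimes>\<^bsub>ext_group G f\<^esub> (\<beta>, y) = (\<alpha> * \<beta> * f x y, x \<otimes>\<^bsub>G\<^esub> y)"
  "\<one>\<^bsub>ext_group G f\<^esub> = (inverse (f \<one>\<^bsub>G\<^esub> \<one>\<^bsub>G\<^esub>), \<one>\<^bsub>G\<^esub>)"
  by (auto simp: ext_group_def)

lemma group_ext_group:
  assumes "group G" "cocycle G f" shows "group (ext_group G f)"
proof -
  interpret group G by fact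
  let ?E = "ext_group G f"
  note nz = cocycle_nonzero[OF assms(2)]
  show ?thesis
  proof (rule groupI)
    fix u v assume "u \<in> carrier ?E" "v \<in> carrier ?E"
    then show "u \<otimes>\<^bsub>?E\<^esub> v \<in> carrier ?E" by (cases u; cases v) (auto simp: nz)
  next
    show "\<one>\<^bsub>?E\<^esub> \<in> carrier ?E" by (simp add: nz)
  next
    fix u v w assume "u \<in> carrier ?E" "v \<in> carrier ?E" "w \<in> carrier ?E"
    then show "(u \<otimes>\<^bsub>?E\<^esub> v) \<otimes>\<^bsub>?E\<^esub> w = u \<otimes>\<^bsub>?E\<^esub> (v \<otimes>\<^bsub>?E\<^esub> w)"
    proof (cases u; cases v; cases w)
      fix \<alpha> x \<beta> y \<gamma> z
      assume *: "u = (\<alpha>, x)" "v = (\<beta>, y)" "w = (\<gamma>, z)"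
      assume "u \<in> carrier ?E" "v \<in> carrier ?E" "w \<in> carrier ?E"
      then have xyz: "x \<in> carrier G" "y \<in> carrier G" "z \<in> carrier G" by (auto simp: *)
      have "(\<alpha> * \<beta> * f x y) * \<gamma> * f (x \<otimes>\<^bsub>G\<^esub> y) z = \<alpha> * (\<beta> * \<gamma> * f y z) * f x (y \<otimes>\<^bsub>G\<^esub> z)"
        using cocycle_eq[OF assms(2) xyz] by (simp add: ac_simps)
      then show ?thesis using xyz by (simp add: * m_assoc)
    qed
  next
    fix u assume "u \<in> carrier ?E"
    then obtain \<alpha> x where u: "u = (\<alpha>, x)" and x: "x \<in> carrier G" by (cases u) auto
    then show "\<one>\<^bsub>?E\<^esub> \<otimes>\<^bsub>?E\<^esub> u = u"
      using nz[of "\<one>\<^bsub>G\<^esub>" "\<one>\<^bsub>G\<^esub>"] by (simp add: cocycle_one(2)[OF assms x])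
  next
    fix u assume u: "u \<in> carrier ?E"
    obtain \<alpha> x where *: "u = (\<alpha>, x)" by (cases u)
    define v where "v = (inverse (f \<one>\<^bsub>G\<^esub> \<one>\<^bsub>G\<^esub>) / (\<alpha> * f (inv\<^bsub>G\<^esub> x) x), inv\<^bsub>G\<^esub> x)"
    have "v \<in> carrier ?E" "v \<otimes>\<^bsub>?E\<^esub> u = \<one>\<^bsub>?E\<^esub>"
      using u nz[of "\<one>\<^bsub>G\<^esub>" "\<one>\<^bsub>G\<^esub>"] nz[of "inv\<^bsub>G\<^esub> x" x] by (auto simp: * v_def)
    then show "\<exists>v\<in>carrier ?E. v \<otimes>\<^bsub>?E\<^esub> u = \<one>\<^bsub>?E\<^esub>" by blast
  qed
qed

lemma ext_group_commute_iff:
  assumes "cocycle G f" "(\<alpha>, x) \<in> carrier (ext_group G f)" "(\<beta>, y) \<in> carrier (ext_group G f)"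
  shows "(\<alpha>, x) \<otimes>\<^bsub>ext_group G f\<^esub> (\<beta>, y) = (\<beta>, y) \<otimes>\<^bsub>ext_group G f\<^esub> (\<alpha>, x) \<longleftrightarrow>
     x \<otimes>\<^bsub>G\<^esub> y = y \<otimes>\<^bsub>G\<^esub> x \<and> commutator_pairing f x y = 1"
  using assms cocycle_nonzero[OF assms(1), of y x] by (auto simp: commutator_pairing_def)

lemma snd_ext_group_pow:
  assumes "group G" "cocycle G f"
  shows "snd (u [^]\<^bsub>ext_group G f\<^esub> (n::nat)) = snd u [^]\<^bsub>G\<^esub> n"
proof -
  have "snd (u \<otimes>\<^bsub>ext_group G f\<^esub> v) = snd u \<otimes>\<^bsub>G\<^esub> snd v" for u v
    by (cases u; cases v) simp
  then show ?thesis by (induction n) (simp_all add: monoid.nat_pow_0)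
qed

lemma (in group) pow_mod:
  assumes "b \<in> carrier G" "b [^] (m::nat) = \<one>"
  shows "b [^] (k::nat) = b [^] (k mod m)"
proof -
  have "b [^] k = b [^] (m * (k div m) + k mod m)" by simp
  also have "\<dots> = b [^] (k mod m)"
    using assms by (simp only: nat_pow_mult[symmetric] nat_pow_pow[symmetric] nat_pow_one l_one nat_pow_closed)
  finally show ?thesis .
qed

text \<open>The quotient by the cyclic group of \<open>a\<close> is given by a surjection instead of
  as a group of cosets, so that \<open>Q\<close> can live on the element type of \<open>G\<close>,
  as an induction over quotients requires. Natural exponents describe the whole kernel because
  \<open>a\<close> has finite order.\<close>

locale central_cyclic_quotient = group_hom G Q \<pi>
  for G :: "('a, 'c) monoid_scheme" (structure) and Q :: "('b, 'd) monoid_scheme" (structure) and \<pi> +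
  fixes a :: 'a
  assumes finite_carrier: "finite (carrier G)"
    and surj: "\<pi> ` carrier G = carrier Q"
    and a_in: "a \<in> carrier G"
    and a_central: "x \<in> carrier G \<Longrightarrow> x \<otimes> a = a \<otimes> x"
    and kernel_iff: "x \<in> carrier G \<Longrightarrow> \<pi> x = \<one>\<^bsub>Q\<^esub> \<longleftrightarrow> (\<exists>i::nat. x = a [^] i)"
begin

definition sec :: "'b \<Rightarrow> 'a" where "sec u = (SOME x. x \<in> carrier G \<and> \<pi> x = u)"

text \<open>Second coordinate of \<open>x\<close> with respect to the transversal
  \<open>sec\<close>. The choice is arbitrary modulo \<open>ord a\<close>, so its additive behaviour
  is visible only through powers of elements killed by \<open>ord a\<close>; see
  \<open>expo_shift\<close>.\<close>

definition expo :: "'a \<Rightarrow> nat" where "expo x = (SOME i. x = sec (\<pi> x) \<otimes> a [^] i)"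

lemma sec: "u \<in> carrier Q \<Longrightarrow> sec u \<in> carrier G \<and> \<pi> (sec u) = u"
  unfolding sec_def surj[symmetric] by (elim imageE, rule someI_ex) auto

lemma sec_in [simp]: "u \<in> carrier Q \<Longrightarrow> sec u \<in> carrier G"
  and \<pi>_sec [simp]: "u \<in> carrier Q \<Longrightarrow> \<pi> (sec u) = u"
  using sec by auto

lemma pow_in [simp]: "a [^] (i::nat) \<in> carrier G" by (simp add: a_in)

lemma \<pi>_pow [simp]: "\<pi> (a [^] (i::nat)) = \<one>\<^bsub>Q\<^esub>" using kernel_iff[OF pow_in] by blast

lemma fibre:
  assumes "x \<in> carrier G" "y \<in> carrier G" "\<pi> x = \<pi> y"
  obtains i :: nat where "y = x \<otimes> a [^] i"
proof -
  have "\<pi> (inv x \<otimes> y) = \<one>\<^bsub>Q\<^esub>" using assms by simp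
  then obtain i :: nat where "inv x \<otimes> y = a [^] i" using kernel_iff[of "inv x \<otimes> y"] assms by auto
  then have "y = x \<otimes> a [^] i" using G.inv_solve_left'[OF pow_in[of i] assms(1,2)] by simp
  then show thesis by (rule that)
qed

lemma expo: assumes "x \<in> carrier G" shows "x = sec (\<pi> x) \<otimes> a [^] expo x"
  unfolding expo_def
proof (rule someI_ex)
  show "\<exists>i. x = sec (\<pi> x) \<otimes> a [^] (i::nat)"
    by (rule fibre[of "sec (\<pi> x)" x]) (use assms in auto)
qed

lemma pow_central: "x \<in> carrier G \<Longrightarrow> x \<otimes> a [^] (i::nat) = a [^] i \<otimes> x"
  using G.group_commutes_pow[of a x i] a_in a_central by simp

lemma ord_pos: "G.ord a > 0"
  using G.ord_ge_1[OF finite_carrier a_in] by simp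

lemma pow_mult_pow:
  assumes "x \<in> carrier G" "y \<in> carrier G"
  shows "(x \<otimes> a [^] (i::nat)) \<otimes> (y \<otimes> a [^] (j::nat)) = (x \<otimes> y) \<otimes> a [^] (i + j)"
proof -
  have "(x \<otimes> a [^] i) \<otimes> (y \<otimes> a [^] j) = x \<otimes> (a [^] i \<otimes> y) \<otimes> a [^] j"
    using assms by (simp add: G.m_assoc)
  also have "\<dots> = x \<otimes> (y \<otimes> a [^] i) \<otimes> a [^] j" by (simp only: pow_central[OF assms(2)])
  also have "\<dots> = (x \<otimes> y) \<otimes> a [^] (i + j)"
    using assms a_in by (simp add: G.m_assoc G.nat_pow_mult)
  finally show ?thesis .
qed

lemma range_pow: "range (\<lambda>i::nat. a [^] i) = generate G {a}"
  using G.generate_pow_nat[OF a_in] ord_pos by auto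

text \<open>Sending \<open>a\<close> to \<open>b\<close> defines a homomorphism on the cyclic group
  of \<open>a\<close>, because the order of \<open>b\<close> divides that of
  \<open>a\<close>.\<close>

lemma pow_eq_pow:
  assumes "group H" "b \<in> carrier H" "b [^]\<^bsub>H\<^esub> G.ord a = \<one>\<^bsub>H\<^esub>" "a [^] (i::nat) = a [^] (j::nat)"
  shows "b [^]\<^bsub>H\<^esub> i = b [^]\<^bsub>H\<^esub> j"
proof -
  have "a [^] (i mod G.ord a) = a [^] (j mod G.ord a)"
    using G.pow_mod[OF a_in G.pow_ord_eq_1[OF a_in], of i] G.pow_mod[OF a_in G.pow_ord_eq_1[OF a_in], of j]
      assms(4) by simp
  moreover have "k mod G.ord a \<in> {0..G.ord a - 1}" for k
    using mod_less_divisor[OF ord_pos, of k] by simp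
  ultimately have "i mod G.ord a = j mod G.ord a"
    using G.ord_inj[OF a_in] by (meson inj_onD)
  then show ?thesis
    using group.pow_mod[OF assms(1-3), of i] group.pow_mod[OF assms(1-3), of j] by simp
qed

text \<open>Used with two groups \<open>H\<close>: the extension, to make a section equivariant, and
  the nonzero complex numbers, to extend a character of the kernel to a function on
  \<open>G\<close>.\<close>

lemma expo_shift:
  assumes "group H" "b \<in> carrier H" "b [^]\<^bsub>H\<^esub> G.ord a = \<one>\<^bsub>H\<^esub>" "x \<in> carrier G"
  shows "b [^]\<^bsub>H\<^esub> expo (x \<otimes> a [^] (i::nat)) = b [^]\<^bsub>H\<^esub> (expo x + i)"
proof (rule pow_eq_pow[OF assms(1-3)])
  have eq: "\<pi> (x \<otimes> a [^] i) = \<pi> x" using assms by simp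
  have "sec (\<pi> x) \<otimes> a [^] expo (x \<otimes> a [^] i) = sec (\<pi> x) \<otimes> a [^] (expo x + i)"
  proof -
    have "sec (\<pi> x) \<otimes> a [^] expo (x \<otimes> a [^] i) = x \<otimes> a [^] i"
      using expo[of "x \<otimes> a [^] i"] assms eq by simp
    also have "\<dots> = sec (\<pi> x) \<otimes> a [^] expo x \<otimes> a [^] i" using expo[of x] assms by simp
    also have "\<dots> = sec (\<pi> x) \<otimes> a [^] (expo x + i)"
      using assms by (simp add: G.m_assoc G.nat_pow_mult a_in)
    finally show ?thesis .
  qed
  then show "a [^] expo (x \<otimes> a [^] i) = a [^] (expo x + i)"
    by (rule G.l_cancel) (simp_all add: assms(4))
qed

lemma descend:
  assumes f: "cocycle G f"
    and inv: "\<And>x y i j. x \<in> carrier G \<Longrightarrow> y \<in> carrier G \<Longrightarrow>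
      f (x \<otimes> a [^] (i::nat)) (y \<otimes> a [^] (j::nat)) = f x y"
  obtains z where "cocycle Q z" "\<And>x y. x \<in> carrier G \<Longrightarrow> y \<in> carrier G \<Longrightarrow> z (\<pi> x) (\<pi> y) = f x y"
proof -
  have fib: "f x y = f x' y'" if 1: "x \<in> carrier G" "y \<in> carrier G" "x' \<in> carrier G" "y' \<in> carrier G"
    "\<pi> x = \<pi> x'" "\<pi> y = \<pi> y'" for x y x' y'
  proof -
    obtain i :: nat where i: "x' = x \<otimes> a [^] i" using fibre 1 by metis
    obtain j :: nat where j: "y' = y \<otimes> a [^] j" using fibre 1 by metis
    show ?thesis unfolding i j using inv 1 by simp
  qed
  define z where "z u v = f (sec u) (sec v)" for u v
  have z: "z (\<pi> x) (\<pi> y) = f x y" if "x \<in> carrier G" "y \<in> carrier G" for x y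
    unfolding z_def using that by (intro fib) auto
  have "cocycle Q z"
    unfolding cocycle_def
  proof (intro conjI ballI)
    fix u v assume "u \<in> carrier Q" "v \<in> carrier Q"
    then show "z u v \<noteq> 0" by (simp add: z_def cocycle_nonzero[OF f])
  next
    fix u v w assume uvw: "u \<in> carrier Q" "v \<in> carrier Q" "w \<in> carrier Q"
    then obtain x y t where xyt: "x \<in> carrier G" "u = \<pi> x" "y \<in> carrier G" "v = \<pi> y" "t \<in> carrier G" "w = \<pi> t"
      by (metis \<pi>_sec sec_in)
    \<comment> \<open>\<open>hom_mult\<close> stays out of the simpset so that the arguments keep
      the form \<open>\<pi> (y \<otimes> t)\<close> on which \<open>z\<close> is known.\<close>
    have "z v w * z u (\<pi> (y \<otimes> t)) = z (\<pi> (x \<otimes> y)) w * z u v"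
      using xyt cocycle_eq[OF f] by (simp add: z del: hom_mult)
    then show "z v w * z u (v \<otimes>\<^bsub>Q\<^esub> w) = z (u \<otimes>\<^bsub>Q\<^esub> v) w * z u v"
      using xyt by simp
  qed
  then show thesis using z by (rule that)
qed

lemma cohomologous_inflate:
  assumes "cohomologous Q z z'"
  shows "cohomologous G (\<lambda>x y. z (\<pi> x) (\<pi> y)) (\<lambda>x y. z' (\<pi> x) (\<pi> y))"
proof -
  obtain g where g: "\<And>x. x \<in> carrier Q \<Longrightarrow> g x \<noteq> 0"
    "\<And>x y. x \<in> carrier Q \<Longrightarrow> y \<in> carrier Q \<Longrightarrow> z x y * g (x \<otimes>\<^bsub>Q\<^esub> y) = z' x y * (g x * g y)"
    using assms by (rule cohomologousE) blast
  show ?thesis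
  proof (rule cohomologousI[where g = "\<lambda>x. g (\<pi> x)"])
    show "g (\<pi> x) \<noteq> 0" if "x \<in> carrier G" for x using g(1) that by simp
    show "z (\<pi> x) (\<pi> y) * g (\<pi> (x \<otimes> y)) = z' (\<pi> x) (\<pi> y) * (g (\<pi> x) * g (\<pi> y))"
      if "x \<in> carrier G" "y \<in> carrier G" for x y
      using g(2)[of "\<pi> x" "\<pi> y"] that by simp
  qed
qed

end

subsection \<open>Inflation and transgression\<close>

lemma complex_root_exists:
  fixes w :: complex assumes "n > 0" obtains z where "z ^ n = w"
proof
  show "rcis (root n (cmod w)) (Arg w / real n) ^ n = w"
    using assms by (simp add: DeMoivre2 real_root_pow_pos2 rcis_cmod_Arg)
qed

lemma (in group) hom_derived_eq_1:
  fixes chi :: "'a \<Rightarrow> complex"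
  assumes nz: "\<And>x. x \<in> carrier G \<Longrightarrow> chi x \<noteq> 0"
    and mult: "\<And>x y. x \<in> carrier G \<Longrightarrow> y \<in> carrier G \<Longrightarrow> chi (x \<otimes> y) = chi x * chi y"
    and "x \<in> derived G (carrier G)"
  shows "chi x = 1"
proof -
  have one: "chi \<one> = 1" using mult[of \<one> \<one>] nz[of \<one>] by simp
  have inv: "chi (inv x) = inverse (chi x)" if "x \<in> carrier G" for x
    using mult[of x "inv x"] that one nz by (simp add: inverse_unique)
  let ?K = "{x \<in> carrier G. chi x = 1}"
  have "subgroup ?K G"
    by (rule subgroupI) (use one inv mult in auto)
  moreover have "derived_set G (carrier G) \<subseteq> ?K"
    using nz by (auto simp: mult inv field_simps)
  ultimately have "derived G (carrier G) \<subseteq> ?K"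
    unfolding derived_def by (rule generate_subgroup_incl[rotated])
  then show ?thesis using assms(3) by auto
qed

context central_cyclic_quotient
begin

text \<open>Exactness at the multiplier of \<open>G\<close> in the dual of Ganea's sequence. The
  trivial pairing says that lifts of \<open>a\<close> are central in the extension; correcting one
  of them to have the order of \<open>a\<close> splits off the kernel.\<close>

lemma cohomologous_inflation:
  assumes f: "cocycle G f"
    and sym: "\<And>x. x \<in> carrier G \<Longrightarrow> commutator_pairing f x a = 1"
  obtains z where "cocycle Q z" "cohomologous G (\<lambda>x y. z (\<pi> x) (\<pi> y)) f"
proof -
  let ?E = "ext_group G f"
  interpret X: group ?E by (rule group_ext_group[OF G.is_group f])
  note nz = cocycle_nonzero[OF f]
  txt \<open>As \<open>f\<close> is not normalized, the scalar \<open>\<beta>\<close> is embedded as \<open>(\<beta> * ?u, \<one>)\<close>.\<close>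
  let ?u = "inverse (f \<one> \<one>)"
  have u0: "f \<one> \<one> \<noteq> 0" using nz by simp
  have scalar: "(\<beta> * ?u, \<one>) \<otimes>\<^bsub>?E\<^esub> (\<alpha>, x) = (\<beta> * \<alpha>, x)" if "x \<in> carrier G" for \<alpha> \<beta> x
    using that u0 by (simp add: cocycle_one(2)[OF G.is_group f that])
  have scalar_pow: "(\<beta> * ?u, \<one>) [^]\<^bsub>?E\<^esub> (n::nat) = (\<beta> ^ n * ?u, \<one>)" for \<beta> n
    using u0 by (induction n) simp_all
  have snd_pow: "snd (w [^]\<^bsub>?E\<^esub> (n::nat)) = snd w [^] n" for w n
    by (rule snd_ext_group_pow[OF G.is_group f])
  have b_central: "(\<beta>, a) \<otimes>\<^bsub>?E\<^esub> w = w \<otimes>\<^bsub>?E\<^esub> (\<beta>, a)" if "\<beta> \<noteq> 0" "w \<in> carrier ?E" for \<beta> w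
  proof (cases w)
    case (Pair \<alpha> x)
    then show ?thesis
      using that a_in a_central[of x] sym[of x] ext_group_commute_iff[OF f, of \<alpha> x \<beta> a]
      by (metis ext_group_simps(1))
  qed
  \<comment> \<open>The power (1, a)^(ord a) lies over the identity, so it equals (c, \<one>) for a
    scalar c. The identity of the extension is (?u, \<one>), hence the lift is rescaled by a root of
    ?u / c.\<close>
  obtain \<gamma> where \<gamma>: "\<gamma> \<noteq> 0" "(\<gamma>, a) [^]\<^bsub>?E\<^esub> G.ord a = \<one>\<^bsub>?E\<^esub>"
  proof -
    let ?w = "(1, a) [^]\<^bsub>?E\<^esub> G.ord a"
    have a1: "(1, a) \<in> carrier ?E" using a_in by simp
    have "snd ?w = \<one>" using a_in by (simp add: snd_pow)
    moreover have "?w \<in> carrier ?E" by (rule X.nat_pow_closed[OF a1])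
    ultimately obtain c where c: "?w = (c, \<one>)" "c \<noteq> 0" by (cases ?w) auto
    obtain \<gamma> where \<gamma>: "\<gamma> ^ G.ord a = ?u / c" by (rule complex_root_exists[OF ord_pos])
    have \<gamma>0: "\<gamma> \<noteq> 0" using \<gamma> c u0 ord_pos by (auto simp: power_0_left)
    have "(\<gamma>, a) = (\<gamma> * ?u, \<one>) \<otimes>\<^bsub>?E\<^esub> (1, a)" using scalar[OF a_in, of \<gamma> 1] by simp
    also have "\<dots> [^]\<^bsub>?E\<^esub> G.ord a = (\<gamma> * ?u, \<one>) [^]\<^bsub>?E\<^esub> G.ord a \<otimes>\<^bsub>?E\<^esub> (1, a) [^]\<^bsub>?E\<^esub> G.ord a"
    proof (rule X.pow_mult_distrib)
      show "(\<gamma> * ?u, \<one>) \<in> carrier ?E" using \<gamma>0 u0 by simp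
      then show "(\<gamma> * ?u, \<one>) \<otimes>\<^bsub>?E\<^esub> (1, a) = (1, a) \<otimes>\<^bsub>?E\<^esub> (\<gamma> * ?u, \<one>)"
        using a_in cocycle_one[OF G.is_group f a_in] by simp
    qed (fact a1)
    also have "\<dots> = (\<gamma> ^ G.ord a * ?u, \<one>) \<otimes>\<^bsub>?E\<^esub> (c, \<one>)"
      by (simp only: scalar_pow c(1))
    also have "\<dots> = \<one>\<^bsub>?E\<^esub>"
      using c(2) u0 by (simp only: scalar[OF G.one_closed] \<gamma>) simp
    finally show thesis using \<gamma>0 by (rule that[rotated])
  qed
  txt \<open>Since \<open>b\<close> is a central lift of \<open>a\<close> of the same order, \<open>\<sigma>\<close> below is a section of the extension
    that is equivariant under powers of \<open>a\<close>, and its factor set \<open>f'\<close> descends to \<open>Q\<close>.\<close>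
  define b where "b = (\<gamma>, a)"
  have b: "b \<in> carrier ?E" "b [^]\<^bsub>?E\<^esub> G.ord a = \<one>\<^bsub>?E\<^esub>"
    using \<gamma> a_in by (auto simp: b_def)
  have b_comm: "b [^]\<^bsub>?E\<^esub> (i::nat) \<otimes>\<^bsub>?E\<^esub> w = w \<otimes>\<^bsub>?E\<^esub> b [^]\<^bsub>?E\<^esub> i" if "w \<in> carrier ?E" for w i
    using X.group_commutes_pow[of b w i] b_central[OF \<gamma>(1) that] b(1) that by (simp only: b_def)
  have b_in [simp]: "b [^]\<^bsub>?E\<^esub> (i::nat) \<in> carrier ?E" for i using b(1) by (rule X.nat_pow_closed)
  define \<sigma> where "\<sigma> x = (1, sec (\<pi> x)) \<otimes>\<^bsub>?E\<^esub> b [^]\<^bsub>?E\<^esub> expo x" for x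
  define t where "t x = fst (\<sigma> x)" for x
  have s1: "(1, sec (\<pi> x)) \<in> carrier ?E" if "x \<in> carrier G" for x using that by simp
  have \<sigma>_in: "\<sigma> x \<in> carrier ?E" if "x \<in> carrier G" for x
    unfolding \<sigma>_def using s1[OF that] b_in by (rule X.m_closed)
  have snd_mult: "snd (v \<otimes>\<^bsub>?E\<^esub> w) = snd v \<otimes> snd w" for v w by (cases v; cases w) simp
  have \<sigma>: "\<sigma> x = (t x, x)" if "x \<in> carrier G" for x
  proof -
    have "snd (\<sigma> x) = x" unfolding \<sigma>_def snd_mult snd_pow using expo[OF that] by (simp add: b_def)
    then show ?thesis by (simp add: t_def prod_eq_iff)
  qed
  have t0: "t x \<noteq> 0" if "x \<in> carrier G" for x using \<sigma>_in[OF that] \<sigma>[OF that] by simp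
  have \<sigma>_shift: "\<sigma> (x \<otimes> a [^] (i::nat)) = \<sigma> x \<otimes>\<^bsub>?E\<^esub> b [^]\<^bsub>?E\<^esub> i" if "x \<in> carrier G" for x i
  proof -
    have "\<sigma> (x \<otimes> a [^] i) = (1, sec (\<pi> x)) \<otimes>\<^bsub>?E\<^esub> b [^]\<^bsub>?E\<^esub> (expo x + i)"
      unfolding \<sigma>_def expo_shift[OF X.is_group b that] using that by simp
    also have "\<dots> = (1, sec (\<pi> x)) \<otimes>\<^bsub>?E\<^esub> (b [^]\<^bsub>?E\<^esub> expo x \<otimes>\<^bsub>?E\<^esub> b [^]\<^bsub>?E\<^esub> i)"
      by (simp only: X.nat_pow_mult[OF b(1)])
    also have "\<dots> = \<sigma> x \<otimes>\<^bsub>?E\<^esub> b [^]\<^bsub>?E\<^esub> i"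
      unfolding \<sigma>_def by (rule X.m_assoc[symmetric]) (use s1[OF that] in simp_all)
    finally show ?thesis .
  qed
  define f' where "f' x y = f x y * t x * t y / t (x \<otimes> y)" for x y
  have \<sigma>_mult: "\<sigma> x \<otimes>\<^bsub>?E\<^esub> \<sigma> y = (f' x y * ?u, \<one>) \<otimes>\<^bsub>?E\<^esub> \<sigma> (x \<otimes> y)"
    if xy: "x \<in> carrier G" "y \<in> carrier G" for x y
  proof -
    have "(f' x y * ?u, \<one>) \<otimes>\<^bsub>?E\<^esub> \<sigma> (x \<otimes> y) = (f' x y * t (x \<otimes> y), x \<otimes> y)"
      using xy by (simp only: \<sigma> scalar G.m_closed)
    also have "\<dots> = \<sigma> x \<otimes>\<^bsub>?E\<^esub> \<sigma> y"
      using xy t0[of "x \<otimes> y"] by (simp add: \<sigma> f'_def)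
    finally show ?thesis ..
  qed
  have f': "cocycle G f'"
    unfolding f'_def using G.is_group f t0 by (rule cocycle_twist)
  have scal_in: "(f' x y * ?u, \<one>) \<in> carrier ?E" if "x \<in> carrier G" "y \<in> carrier G" for x y
    using cocycle_nonzero[OF f' that] u0 by simp
  \<comment> \<open>Both sides are read off from the product of \<sigma> (x a^i) and \<sigma> (y
    a^j): once directly as a factor set value, once after moving the central powers of
    \<open>b\<close> to the right. Cancelling the common value of \<sigma> compares the
    scalars.\<close>
  have "f' (x \<otimes> a [^] (i::nat)) (y \<otimes> a [^] (j::nat)) = f' x y"
    if xy: "x \<in> carrier G" "y \<in> carrier G" for x y i j
  proof -
    have xy': "x \<otimes> a [^] i \<in> carrier G" "y \<otimes> a [^] j \<in> carrier G" using xy by auto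
    note prod = pow_mult_pow[OF xy]
    have "(f' (x \<otimes> a [^] i) (y \<otimes> a [^] j) * ?u, \<one>) \<otimes>\<^bsub>?E\<^esub> \<sigma> ((x \<otimes> y) \<otimes> a [^] (i + j)) =
        (\<sigma> x \<otimes>\<^bsub>?E\<^esub> b [^]\<^bsub>?E\<^esub> i) \<otimes>\<^bsub>?E\<^esub> (\<sigma> y \<otimes>\<^bsub>?E\<^esub> b [^]\<^bsub>?E\<^esub> j)"
      using \<sigma>_mult[OF xy'] \<sigma>_shift xy prod by metis
    also have "\<dots> = \<sigma> x \<otimes>\<^bsub>?E\<^esub> (b [^]\<^bsub>?E\<^esub> i \<otimes>\<^bsub>?E\<^esub> \<sigma> y) \<otimes>\<^bsub>?E\<^esub> b [^]\<^bsub>?E\<^esub> j"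
      using \<sigma>_in[OF xy(1)] \<sigma>_in[OF xy(2)] by (simp only: X.m_assoc X.m_closed b_in)
    also have "\<dots> = \<sigma> x \<otimes>\<^bsub>?E\<^esub> \<sigma> y \<otimes>\<^bsub>?E\<^esub> (b [^]\<^bsub>?E\<^esub> i \<otimes>\<^bsub>?E\<^esub> b [^]\<^bsub>?E\<^esub> j)"
      using \<sigma>_in[OF xy(1)] \<sigma>_in[OF xy(2)]
      by (simp only: b_comm[OF \<sigma>_in[OF xy(2)]] X.m_assoc X.m_closed b_in)
    also have "\<dots> = (f' x y * ?u, \<one>) \<otimes>\<^bsub>?E\<^esub> \<sigma> (x \<otimes> y) \<otimes>\<^bsub>?E\<^esub> b [^]\<^bsub>?E\<^esub> (i + j)"
      by (simp only: \<sigma>_mult[OF xy] X.nat_pow_mult[OF b(1)])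
    also have "\<dots> = (f' x y * ?u, \<one>) \<otimes>\<^bsub>?E\<^esub> \<sigma> ((x \<otimes> y) \<otimes> a [^] (i + j))"
      using \<sigma>_in[of "x \<otimes> y"] scal_in[OF xy] xy
      by (simp only: X.m_assoc \<sigma>_shift G.m_closed b_in)
    finally have "(f' (x \<otimes> a [^] i) (y \<otimes> a [^] j) * ?u, \<one>) = (f' x y * ?u, \<one>)"
      by (rule X.r_cancel) (use \<sigma>_in[of "(x \<otimes> y) \<otimes> a [^] (i + j)"] scal_in[OF xy] scal_in[OF xy'] xy in simp_all)
    then show ?thesis using u0 by simp
  qed
  then obtain z where z: "cocycle Q z" "\<And>x y. x \<in> carrier G \<Longrightarrow> y \<in> carrier G \<Longrightarrow> z (\<pi> x) (\<pi> y) = f' x y"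
    using descend[OF f'] by blast
  have "cohomologous G (\<lambda>x y. z (\<pi> x) (\<pi> y)) f"
  proof (rule cohomologousI[where g = t])
    show "z (\<pi> x) (\<pi> y) * t (x \<otimes> y) = f x y * (t x * t y)" if "x \<in> carrier G" "y \<in> carrier G" for x y
      using that t0[of "x \<otimes> y"] by (simp add: z f'_def)
  qed (fact t0)
  with z(1) show thesis by (rule that)
qed

text \<open>The connecting map from characters of the kernel to classes of \<open>Q\<close>. Its own
  kernel consists of the characters that extend to \<open>G\<close>, and on an element of the
  commutator subgroup these take the value 1, so the map is injective here.\<close>

lemma transgression:
  assumes "a \<in> derived G (carrier G)"
  obtains z :: "nat \<Rightarrow> 'b \<Rightarrow> 'b \<Rightarrow> complex"
  where "\<And>i. cocycle Q (z i)" "\<And>i. cohomologous G (\<lambda>x y. z i (\<pi> x) (\<pi> y)) (\<lambda>x y. 1)"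
    "\<And>i j. i < G.ord a \<Longrightarrow> j < G.ord a \<Longrightarrow> cohomologous Q (z i) (z j) \<Longrightarrow> i = j"
proof -
  let ?m = "G.ord a"
  define \<omega> where "\<omega> = cis (2 * pi / ?m)"
  have \<omega>0: "\<omega> \<noteq> 0" by (simp add: \<omega>_def)
  have \<omega>m: "\<omega> ^ ?m = 1" using ord_pos by (simp add: \<omega>_def DeMoivre)
  have \<omega>_inj: "i = j" if "i < ?m" "j < ?m" "\<omega> ^ i = \<omega> ^ j" for i j
    using bij_betw_imp_inj_on[OF bij_betw_roots_unity[OF ord_pos]] that
    by (auto simp: inj_on_def \<omega>_def DeMoivre mult.commute field_simps)
  let ?C = "complex_units"
  interpret C: comm_group ?C by (rule comm_group_complex_units)
  have C_pow: "x [^]\<^bsub>?C\<^esub> (n::nat) = x ^ n" for x n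
    by (induction n) (simp_all add: complex_units_def mult.commute)
  txt \<open>\<open>g i\<close> extends the character \<open>a \<mapsto> \<omega> ^ i\<close> of the kernel to a function on \<open>G\<close>; its coboundary
    descends to \<open>Q\<close>.\<close>
  define g where "g i x = (\<omega> ^ i) ^ expo x" for i x
  have g0: "g i x \<noteq> 0" for i x by (simp add: g_def \<omega>0)
  have g_shift: "g i (x \<otimes> a [^] (k::nat)) = g i x * (\<omega> ^ i) ^ k" if "x \<in> carrier G" for i x k
  proof -
    have "\<omega> ^ i \<in> carrier ?C" using \<omega>0 by (simp add: complex_units_def)
    moreover have "(\<omega> ^ i) [^]\<^bsub>?C\<^esub> ?m = \<one>\<^bsub>?C\<^esub>"
      using \<omega>m unfolding C_pow by (metis complex_units_def monoid.select_convs(2) power_mult mult.commute power_one)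
    ultimately show ?thesis
      using expo_shift[OF C.is_group _ _ that, of "\<omega> ^ i" k] by (simp add: C_pow g_def power_add)
  qed
  define F where "F i x y = 1 * g i x * g i y / g i (x \<otimes> y)" for i x y
  have F: "cocycle G (F i)" for i
    unfolding F_def by (rule cocycle_twist[OF G.is_group]) (auto simp: g0 cocycle_def)
  have "\<exists>z. cocycle Q z \<and> (\<forall>x\<in>carrier G. \<forall>y\<in>carrier G. z (\<pi> x) (\<pi> y) = F i x y)" for i
  proof (rule descend[OF F[of i]])
    fix x y and k l :: nat assume xy: "x \<in> carrier G" "y \<in> carrier G"
    show "F i (x \<otimes> a [^] k) (y \<otimes> a [^] l) = F i x y"
      unfolding F_def pow_mult_pow[OF xy] using xy \<omega>0 by (simp add: g_shift power_add)
  qed blast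
  then obtain z where z: "\<And>i. cocycle Q (z i)"
    "\<And>i x y. x \<in> carrier G \<Longrightarrow> y \<in> carrier G \<Longrightarrow> z i (\<pi> x) (\<pi> y) = F i x y" by metis
  show thesis
  proof (rule that[OF z(1)])
    show "cohomologous G (\<lambda>x y. z i (\<pi> x) (\<pi> y)) (\<lambda>x y. 1)" for i
      by (rule cohomologousI[where g = "g i"]) (auto simp: g0 z F_def)
  next
    fix i j assume ij: "i < ?m" "j < ?m" "cohomologous Q (z i) (z j)"
    obtain h where h: "\<And>u. u \<in> carrier Q \<Longrightarrow> h u \<noteq> 0"
      "\<And>u v. u \<in> carrier Q \<Longrightarrow> v \<in> carrier Q \<Longrightarrow> z i u v * h (u \<otimes>\<^bsub>Q\<^esub> v) = z j u v * (h u * h v)"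
      using ij(3) by (rule cohomologousE) blast
    \<comment> \<open>If the classes agree via \<open>h\<close>, then g i and g j times the pullback
      of \<open>h\<close> have the same coboundary, so their quotient is a character of
      \<open>G\<close>. It changes by the factor \<omega>^i / \<omega>^j from \<one> to
      \<open>a\<close>, yet is 1 at both.\<close>
    define chi where "chi x = g i x / (g j x * h (\<pi> x))" for x
    have chi0: "chi x \<noteq> 0" if "x \<in> carrier G" for x using that h(1) g0 by (simp add: chi_def)
    have chi_mult: "chi (x \<otimes> y) = chi x * chi y" if xy: "x \<in> carrier G" "y \<in> carrier G" for x y
    proof -
      have "F i x y * h (\<pi> (x \<otimes> y)) = F j x y * (h (\<pi> x) * h (\<pi> y))"
        using h(2)[of "\<pi> x" "\<pi> y"] xy by (simp add: z)
      moreover have "h (\<pi> x) \<noteq> 0" "h (\<pi> y) \<noteq> 0" "h (\<pi> (x \<otimes> y)) \<noteq> 0"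
        using h(1) xy by auto
      ultimately show ?thesis
        unfolding chi_def F_def using g0 by (simp add: field_simps del: hom_mult)
    qed
    have "chi a = 1" using chi0 chi_mult assms by (rule G.hom_derived_eq_1)
    moreover have "chi \<one> = 1" using chi_mult[of \<one> \<one>] chi0[of \<one>] by simp
    moreover have "chi a * \<omega> ^ j = chi \<one> * \<omega> ^ i"
      using g_shift[of \<one> i 1] g_shift[of \<one> j 1] a_in \<pi>_pow[of 1] g0 \<omega>0
      by (simp add: chi_def)
    ultimately show "i = j" using \<omega>_inj[OF ij(1,2)] by simp
  qed
qed

end

subsection \<open>Counting commutator pairings\<close>

lemma commutator_pairing_divide:
  "commutator_pairing (\<lambda>x y. f x y / g x y) x y = commutator_pairing f x y / commutator_pairing g x y"
  by (simp add: commutator_pairing_def)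

lemma commutator_pairing_nonzero:
  "cocycle G f \<Longrightarrow> x \<in> carrier G \<Longrightarrow> y \<in> carrier G \<Longrightarrow> commutator_pairing f x y \<noteq> 0"
  by (simp add: commutator_pairing_def cocycle_nonzero)

lemma (in group) hom_eq_on_generate:
  fixes chi psi :: "'a \<Rightarrow> complex"
  assumes "\<And>x. x \<in> carrier G \<Longrightarrow> chi x \<noteq> 0" "\<And>x. x \<in> carrier G \<Longrightarrow> psi x \<noteq> 0"
    and "\<And>x y. x \<in> carrier G \<Longrightarrow> y \<in> carrier G \<Longrightarrow> chi (x \<otimes> y) = chi x * chi y"
    and "\<And>x y. x \<in> carrier G \<Longrightarrow> y \<in> carrier G \<Longrightarrow> psi (x \<otimes> y) = psi x * psi y"
    and S: "S \<subseteq> carrier G" "\<And>x. x \<in> S \<Longrightarrow> chi x = psi x" and "x \<in> generate G S"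
  shows "chi x = psi x"
proof -
  have one: "chi \<one> = 1" "psi \<one> = 1"
    using assms(3)[of \<one> \<one>] assms(1)[of \<one>] assms(4)[of \<one> \<one>] assms(2)[of \<one>] by simp_all
  have inv: "chi (inv x) = inverse (chi x)" "psi (inv x) = inverse (psi x)" if "x \<in> carrier G" for x
    using assms(3,4)[of x "inv x"] that one assms(1,2) by (simp_all add: inverse_unique)
  have "subgroup {x \<in> carrier G. chi x = psi x} G"
    by (rule subgroupI) (use one inv assms(3,4) in auto)
  moreover have "S \<subseteq> {x \<in> carrier G. chi x = psi x}" using S by auto
  ultimately have "generate G S \<subseteq> {x \<in> carrier G. chi x = psi x}"
    by (rule generate_subgroup_incl[rotated])
  then show ?thesis using assms(7) by auto
qed

text \<open>The sum of \<open>\<bar>\<Sum>\<chi>. \<chi> x\<bar>\<^sup>2\<close> over \<open>G\<close> is \<open>card F * order G\<close> by orthogonality, and each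
  point of \<open>K\<close> contributes \<open>(card F)\<^sup>2\<close>.\<close>

lemma (in group) card_characters_le:
  fixes F :: "('a \<Rightarrow> complex) set"
  assumes fin: "finite (carrier G)" and F: "finite F" "F \<subseteq> extensional (carrier G)"
    and nz: "\<And>chi x. chi \<in> F \<Longrightarrow> x \<in> carrier G \<Longrightarrow> chi x \<noteq> 0"
    and mult: "\<And>chi x y. chi \<in> F \<Longrightarrow> x \<in> carrier G \<Longrightarrow> y \<in> carrier G \<Longrightarrow> chi (x \<otimes> y) = chi x * chi y"
    and K: "K \<subseteq> carrier G" "\<And>chi x. chi \<in> F \<Longrightarrow> x \<in> K \<Longrightarrow> chi x = 1"
  shows "card F * card K \<le> order G"
proof (cases "F = {}")
  case False
  have one: "chi \<one> = 1" if "chi \<in> F" for chi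
    using mult[OF that, of \<one> \<one>] nz[OF that, of \<one>] by simp
  have pow: "chi (x [^] (n::nat)) = chi x ^ n" if "chi \<in> F" "x \<in> carrier G" for chi x n
    using that by (induction n) (simp_all add: one mult)
  have norm: "cmod (chi x) = 1" if "chi \<in> F" "x \<in> carrier G" for chi x
  proof -
    have "chi x ^ order G = 1"
      using pow[OF that, of "order G"] pow_order_eq_1[OF that(2)] one[OF that(1)] by simp
    moreover have "order G > 0" using fin order_gt_0_iff_finite by blast
    ultimately show ?thesis
      using power_eq_1_iff[of "chi x" "order G"] by simp
  qed
  have cnj: "chi x * cnj (chi x) = 1" if "chi \<in> F" "x \<in> carrier G" for chi x
    using norm[OF that] by (simp add: complex_norm_square[symmetric])
  have orth: "(\<Sum>x\<in>carrier G. chi x * cnj (psi x)) = (if chi = psi then of_nat (order G) else 0)"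
    if "chi \<in> F" "psi \<in> F" for chi psi
  proof (cases "chi = psi")
    case True
    then show ?thesis using cnj that by (simp add: order_def)
  next
    case False
    \<comment> \<open>Extensionality turns inequality of functions into inequality at a point of the
      carrier.\<close>
    have "chi \<in> extensional (carrier G)" "psi \<in> extensional (carrier G)"
      using that F(2) by auto
    with False obtain y where y: "y \<in> carrier G" "chi y \<noteq> psi y"
      by (blast intro: extensionalityI)
    let ?T = "\<Sum>x\<in>carrier G. chi x * cnj (psi x)"
    have canc: "y \<otimes> (inv y \<otimes> x) = x" "inv y \<otimes> (y \<otimes> x) = x" if "x \<in> carrier G" for x
      using m_assoc[of y "inv y" x] m_assoc[of "inv y" y x] y(1) that by simp_all
    \<comment> \<open>Translating the summation variable by \<open>y\<close> multiplies the sum by a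
      number other than 1, so the sum vanishes.\<close>
    have "?T = (\<Sum>x\<in>carrier G. chi (y \<otimes> x) * cnj (psi (y \<otimes> x)))"
      by (rule sum.reindex_bij_witness[where i = "\<lambda>x. y \<otimes> x" and j = "\<lambda>x. inv y \<otimes> x"])
        (use y(1) in \<open>simp_all add: canc\<close>)
    also have "\<dots> = chi y * cnj (psi y) * ?T"
      using that y by (simp add: mult sum_distrib_left ac_simps)
    finally have "(1 - chi y * cnj (psi y)) * ?T = 0" by (simp add: algebra_simps)
    moreover have "chi y * cnj (psi y) \<noteq> 1"
      using y(2) cnj[OF that(2) y(1)] nz[OF that(2) y(1)] by (metis complex_cnj_zero_iff mult_cancel_right)
    ultimately show ?thesis using False by simp
  qed
  have "complex_of_real (\<Sum>x\<in>carrier G. (cmod (\<Sum>chi\<in>F. chi x))\<^sup>2)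
      = (\<Sum>x\<in>carrier G. (\<Sum>chi\<in>F. chi x) * cnj (\<Sum>psi\<in>F. psi x))"
    by (simp only: of_real_sum complex_norm_square)
  also have "\<dots> = (\<Sum>x\<in>carrier G. \<Sum>chi\<in>F. \<Sum>psi\<in>F. chi x * cnj (psi x))"
    by (simp add: sum_product)
  also have "\<dots> = (\<Sum>chi\<in>F. \<Sum>x\<in>carrier G. \<Sum>psi\<in>F. chi x * cnj (psi x))"
    by (rule sum.swap)
  also have "\<dots> = (\<Sum>chi\<in>F. \<Sum>psi\<in>F. \<Sum>x\<in>carrier G. chi x * cnj (psi x))"
    by (intro sum.cong refl sum.swap)
  also have "\<dots> = (\<Sum>chi\<in>F. of_nat (order G))"
    using F(1) by (intro sum.cong refl) (simp add: orth)
  finally have "complex_of_real (\<Sum>x\<in>carrier G. (cmod (\<Sum>chi\<in>F. chi x))\<^sup>2) = complex_of_real (card F * order G)"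
    by simp
  then have total: "(\<Sum>x\<in>carrier G. (cmod (\<Sum>chi\<in>F. chi x))\<^sup>2) = card F * order G"
    by (simp only: of_real_eq_iff)
  have "(\<Sum>chi\<in>F. chi x) = of_nat (card F)" if "x \<in> K" for x
    using sum.cong[OF refl K(2)[OF _ that], of F] by simp
  then have "real (card F * (card F * card K)) = (\<Sum>x\<in>K. (cmod (\<Sum>chi\<in>F. chi x))\<^sup>2)"
    by (simp add: power2_eq_square)
  also have "\<dots> \<le> (\<Sum>x\<in>carrier G. (cmod (\<Sum>chi\<in>F. chi x))\<^sup>2)"
    using fin K(1) by (intro sum_mono2) auto
  finally have "card F * (card F * card K) \<le> card F * order G"
    unfolding total by (simp only: of_nat_le_iff)
  then show ?thesis using False F(1) by (simp add: card_gt_0_iff)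
qed simp

text \<open>Conjugation by \<open>z\<close> turns \<open>x\<close>, \<open>y\<close> into
  \<open>x u\<close>, \<open>y v\<close>. As \<open>u\<close> and \<open>v\<close> commute with each
  other and each with the opposite generator, both products xy and yx acquire the same right factor
  q = uv, which cancels in (xy)(yx)^-1.\<close>

lemma (in group) commutator_commute:
  assumes "x \<in> carrier G" "y \<in> carrier G" "z \<in> carrier G" "u \<in> carrier G" "v \<in> carrier G"
    and "z \<otimes> x = x \<otimes> u \<otimes> z" "z \<otimes> y = y \<otimes> v \<otimes> z"
    and "u \<otimes> y = y \<otimes> u" "v \<otimes> x = x \<otimes> v" "u \<otimes> v = v \<otimes> u"
  shows "z \<otimes> (x \<otimes> y \<otimes> inv x \<otimes> inv y) = x \<otimes> y \<otimes> inv x \<otimes> inv y \<otimes> z"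
proof -
  define P R q where "P = x \<otimes> y" and "R = y \<otimes> x" and "q = u \<otimes> v"
  have in_G [simp]: "P \<in> carrier G" "R \<in> carrier G" "q \<in> carrier G"
    using assms by (auto simp: P_def R_def q_def)
  have "z \<otimes> P = (z \<otimes> x) \<otimes> y" using assms(1-5) by (simp add: P_def m_assoc)
  also have "\<dots> = x \<otimes> u \<otimes> (z \<otimes> y)" using assms(1-5) by (simp add: assms(6) m_assoc)
  also have "\<dots> = x \<otimes> (u \<otimes> y) \<otimes> v \<otimes> z" using assms(1-5) by (simp add: assms(7) m_assoc)
  also have "\<dots> = P \<otimes> q \<otimes> z" using assms(1-5) by (simp add: assms(8) P_def q_def m_assoc)
  finally have ZP: "z \<otimes> P = P \<otimes> q \<otimes> z" .
  have "z \<otimes> R = (z \<otimes> y) \<otimes> x" using assms(1-5) by (simp add: R_def m_assoc)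
  also have "\<dots> = y \<otimes> v \<otimes> (z \<otimes> x)" using assms(1-5) by (simp add: assms(7) m_assoc)
  also have "\<dots> = y \<otimes> (v \<otimes> x) \<otimes> u \<otimes> z" using assms(1-5) by (simp add: assms(6) m_assoc)
  also have "\<dots> = y \<otimes> x \<otimes> (v \<otimes> u) \<otimes> z" using assms(1-5) by (simp add: assms(9) m_assoc)
  also have "\<dots> = R \<otimes> q \<otimes> z" by (simp only: assms(10) R_def q_def)
  finally have ZR: "z \<otimes> R = R \<otimes> q \<otimes> z" .
  have W: "x \<otimes> y \<otimes> inv x \<otimes> inv y = P \<otimes> inv R"
    using assms by (simp add: P_def R_def inv_mult_group m_assoc)
  have "inv R \<otimes> z = inv R \<otimes> (z \<otimes> R) \<otimes> inv R" using assms(3) by (simp add: m_assoc)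
  also have "\<dots> = q \<otimes> z \<otimes> inv R"
    unfolding ZR using assms(3) by (simp add: m_assoc[symmetric])
  finally have "P \<otimes> inv R \<otimes> z = P \<otimes> q \<otimes> z \<otimes> inv R"
    using assms(3) by (simp add: m_assoc)
  also have "\<dots> = z \<otimes> (P \<otimes> inv R)" using assms(3) by (simp add: ZP[symmetric] m_assoc)
  finally show ?thesis unfolding W ..
qed

context central_cyclic_quotient
begin

text \<open>Restricting to the carrier makes equality of pairings mean equality on \<open>G\<close>,
  so that the set is finite and can be counted.\<close>

definition pairings :: "('a \<Rightarrow> complex) set" where
  "pairings = (\<lambda>f. \<lambda>x\<in>carrier G. commutator_pairing f x a) ` {f. cocycle G f}"

lemma pairing_mult:
  "cocycle G f \<Longrightarrow> x \<in> carrier G \<Longrightarrow> y \<in> carrier G \<Longrightarrow>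
    commutator_pairing f (x \<otimes> y) a = commutator_pairing f x a * commutator_pairing f y a"
  using commutator_pairing_mult[OF G.is_group, of f x y a] a_in a_central by simp

lemma pairing_pow_ord:
  "cocycle G f \<Longrightarrow> x \<in> carrier G \<Longrightarrow> commutator_pairing f x a ^ G.ord a = 1"
  using commutator_pairing_pow_ord[OF G.is_group, of f x a] a_in a_central by simp

lemma pairing_nonzero: "cocycle G f \<Longrightarrow> x \<in> carrier G \<Longrightarrow> commutator_pairing f x a \<noteq> 0"
  by (rule commutator_pairing_nonzero[OF _ _ a_in])

lemma finite_pairings: "finite pairings"
proof (rule finite_subset)
  show "pairings \<subseteq> (\<Pi>\<^sub>E x\<in>carrier G. {w. w ^ G.ord a = 1})"
    by (auto simp: pairings_def pairing_pow_ord)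
  show "finite (\<Pi>\<^sub>E x\<in>carrier G. {w :: complex. w ^ G.ord a = 1})"
    using ord_pos by (intro finite_PiE finite_carrier finite_roots_unity) simp
qed

lemma card_pairings_generators:
  assumes S: "S \<subseteq> carrier G" "generate G S = carrier G"
  shows "card pairings \<le> G.ord a ^ card S"
proof -
  let ?R = "{w :: complex. w ^ G.ord a = 1}"
  have R: "finite ?R" "card ?R \<le> G.ord a"
    using ord_pos by (simp_all add: finite_roots_unity card_roots_unity)
  have finS: "finite S" using S(1) finite_carrier by (rule finite_subset)
  have "card pairings \<le> card (\<Pi>\<^sub>E x\<in>S. ?R)"
  proof (rule card_inj_on_le)
    show "inj_on (\<lambda>h. restrict h S) pairings"
    proof (rule inj_onI)
      fix h k assume hk: "h \<in> pairings" "k \<in> pairings" "restrict h S = restrict k S"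
      then obtain f g where fg: "cocycle G f" "h = (\<lambda>x\<in>carrier G. commutator_pairing f x a)"
        "cocycle G g" "k = (\<lambda>x\<in>carrier G. commutator_pairing g x a)" by (auto simp: pairings_def)
      have eq: "commutator_pairing f x a = commutator_pairing g x a" if "x \<in> S" for x
        using fun_cong[OF hk(3), of x] that S(1) by (auto simp: fg(2,4))
      have "commutator_pairing f x a = commutator_pairing g x a" if "x \<in> carrier G" for x
        by (rule G.hom_eq_on_generate[where S = S])
          (use that S eq fg in \<open>simp_all add: pairing_mult pairing_nonzero\<close>)
      then show "h = k" by (auto simp: fg(2,4) fun_eq_iff)
    qed
    show "(\<lambda>h. restrict h S) ` pairings \<subseteq> (\<Pi>\<^sub>E x\<in>S. ?R)"
      using S(1) by (auto simp: pairings_def pairing_pow_ord subset_iff)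
    show "finite (\<Pi>\<^sub>E x\<in>S. ?R)" using finS R(1) by (rule finite_PiE)
  qed
  also have "\<dots> = card ?R ^ card S" using finS by (simp add: card_PiE)
  also have "\<dots> \<le> G.ord a ^ card S" using R(2) by (rule power_mono) simp
  finally show ?thesis .
qed

text \<open>The pairing is alternating: f(a,a) / f(a,a) = 1. So every member is a character trivial
  on the powers of \<open>a\<close>.\<close>

lemma card_pairings_order: "card pairings * G.ord a \<le> order G"
proof -
  have "card pairings * card (range (\<lambda>i::nat. a [^] i)) \<le> order G"
  proof (rule G.card_characters_le)
    fix chi x assume chi: "chi \<in> pairings" and "x \<in> range (\<lambda>i::nat. a [^] i)"
    then obtain i :: nat where x: "x = a [^] i" by auto
    obtain f where f: "cocycle G f" "chi = (\<lambda>x\<in>carrier G. commutator_pairing f x a)"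
      using chi by (auto simp: pairings_def)
    have "commutator_pairing f a a = 1"
      using cocycle_nonzero[OF f(1) a_in a_in] by (simp add: commutator_pairing_def)
    then show "chi x = 1"
      using commutator_pairing_pow[OF G.is_group f(1) a_in a_in] by (simp add: f(2) x)
  qed (use finite_pairings in \<open>auto simp: finite_carrier pairings_def pairing_mult pairing_nonzero\<close>)
  moreover have "card (range (\<lambda>i::nat. a [^] i)) = G.ord a"
    unfolding range_pow by (rule G.generate_pow_card[OF a_in, symmetric])
  ultimately show ?thesis by simp
qed

text \<open>In the central extension of \<open>f\<close>, a lift \<open>gz\<close> of \<open>z\<close> conjugates the lifts \<open>gx\<close>, \<open>gy\<close> of
  \<open>x\<close>, \<open>y\<close> to \<open>gx \<otimes> c gx\<close>, \<open>gy \<otimes> c gy\<close> with factors lying over powers of \<open>a\<close>. These commute with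
  \<open>gx\<close>, \<open>gy\<close> and each other, so \<open>gz\<close> centralizes the commutator of \<open>gx\<close> and \<open>gy\<close>, a lift of \<open>a\<close>.\<close>

lemma pairing_trivial:
  assumes f: "cocycle G f" and xy: "x \<in> carrier G" "y \<in> carrier G"
    and a: "a = x \<otimes> y \<otimes> inv x \<otimes> inv y"
    and der: "derived G (carrier G) \<subseteq> range (\<lambda>i::nat. a [^] i)"
    and fx: "commutator_pairing f x a = 1" and fy: "commutator_pairing f y a = 1"
    and z: "z \<in> carrier G"
  shows "commutator_pairing f z a = 1"
proof -
  let ?E = "ext_group G f"
  interpret X: group ?E by (rule group_ext_group[OF G.is_group f])
  have snd_mult: "snd (v \<otimes>\<^bsub>?E\<^esub> w) = snd v \<otimes> snd w" for v w by (cases v; cases w) simp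
  have "group_hom ?E G snd"
    by unfold_locales (auto simp: hom_def snd_mult)
  then interpret S: group_hom ?E G snd .
  \<comment> \<open>The pairing of a^i with t is a power of the inverse of the pairing of t with
    \<open>a\<close>; when the latter is 1, any lifts of a^i and t commute.\<close>
  have com: "v \<otimes>\<^bsub>?E\<^esub> w = w \<otimes>\<^bsub>?E\<^esub> v"
    if vw: "v \<in> carrier ?E" "w \<in> carrier ?E" "snd v \<in> range (\<lambda>i::nat. a [^] i)" "commutator_pairing f (snd w) a = 1" for v w
  proof -
    obtain \<alpha> i where v: "v = (\<alpha>, a [^] (i::nat))" using vw(3) by (cases v) auto
    obtain \<beta> t where w: "w = (\<beta>, t)" by (cases w)
    have t: "t \<in> carrier G" using vw(2) w by simp
    have "commutator_pairing f (a [^] i) t = commutator_pairing f a t ^ i"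
      by (rule commutator_pairing_pow[OF G.is_group f a_in t a_central[OF t]])
    also have "commutator_pairing f a t = 1"
      using vw(4) by (subst commutator_pairing_sym) (simp add: w)
    finally show ?thesis
      using ext_group_commute_iff[OF f, of \<alpha> "a [^] i" \<beta> t] vw(1,2) pow_central[OF t] by (simp add: v w)
  qed
  have pa: "commutator_pairing f (a [^] (i::nat)) a = 1" for i
  proof -
    have "commutator_pairing f a a = 1"
      using cocycle_nonzero[OF f a_in a_in] by (simp add: commutator_pairing_def)
    then show ?thesis using commutator_pairing_pow[OF G.is_group f a_in a_in] by simp
  qed
  define gx gy gz where "gx = (1::complex, x)" and "gy = (1::complex, y)" and "gz = (1::complex, z)"
  have in_E: "gx \<in> carrier ?E" "gy \<in> carrier ?E" "gz \<in> carrier ?E"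
    using xy z by (auto simp: gx_def gy_def gz_def)
  \<comment> \<open>The correction factor in gz t = t (c t) gz. Being a commutator, it lies over the
    commutator subgroup and hence over a power of \<open>a\<close>.\<close>
  define c where "c t = inv\<^bsub>?E\<^esub> t \<otimes>\<^bsub>?E\<^esub> gz \<otimes>\<^bsub>?E\<^esub> t \<otimes>\<^bsub>?E\<^esub> inv\<^bsub>?E\<^esub> gz" for t
  have c_in: "c t \<in> carrier ?E" if "t \<in> carrier ?E" for t using that in_E by (simp add: c_def del: ext_group_simps)
  have c_der: "snd (c t) \<in> range (\<lambda>i::nat. a [^] i)" if "t \<in> carrier ?E" for t
  proof -
    have st: "snd t \<in> carrier G" using S.hom_closed[OF that] .
    have "snd (c t) = inv (snd t) \<otimes> z \<otimes> inv (inv (snd t)) \<otimes> inv z"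
      using that in_E st by (simp add: c_def snd_mult del: ext_group_simps) (simp add: gz_def)
    also have "\<dots> \<in> derived_set G (carrier G)" using st z by blast
    also have "\<dots> \<subseteq> derived G (carrier G)" unfolding derived_def by (auto intro: generate.incl)
    finally show ?thesis using der by blast
  qed
  have Zc: "gz \<otimes>\<^bsub>?E\<^esub> t = t \<otimes>\<^bsub>?E\<^esub> c t \<otimes>\<^bsub>?E\<^esub> gz" if "t \<in> carrier ?E" for t
    using that in_E by (simp add: c_def X.m_assoc[symmetric] del: ext_group_simps) (simp add: X.m_assoc del: ext_group_simps)
  let ?W = "gx \<otimes>\<^bsub>?E\<^esub> gy \<otimes>\<^bsub>?E\<^esub> inv\<^bsub>?E\<^esub> gx \<otimes>\<^bsub>?E\<^esub> inv\<^bsub>?E\<^esub> gy"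
  have W: "?W \<in> carrier ?E" "snd ?W = a"
    using in_E xy by (simp_all add: snd_mult a del: ext_group_simps) (simp add: gx_def gy_def)
  have "gz \<otimes>\<^bsub>?E\<^esub> ?W = ?W \<otimes>\<^bsub>?E\<^esub> gz"
  proof (rule X.commutator_commute[of gx gy gz "c gx" "c gy"])
    show "c gx \<otimes>\<^bsub>?E\<^esub> gy = gy \<otimes>\<^bsub>?E\<^esub> c gx" "c gy \<otimes>\<^bsub>?E\<^esub> gx = gx \<otimes>\<^bsub>?E\<^esub> c gy"
      using in_E fx fy by (auto intro!: com c_in c_der simp: gx_def gy_def)
    show "c gx \<otimes>\<^bsub>?E\<^esub> c gy = c gy \<otimes>\<^bsub>?E\<^esub> c gx"
      using in_E c_der[of gy] pa by (intro com c_in c_der) auto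
  qed (use in_E c_in Zc in auto)
  \<comment> \<open>\<open>?W\<close> is some lift of \<open>a\<close>, with unknown scalar;
    commuting with gz is independent of that scalar and so detects the pairing of \<open>z\<close>
    with \<open>a\<close>.\<close>
  then show ?thesis
    using ext_group_commute_iff[OF f, of 1 z "fst ?W" a] W z a_in
    by (metis X.m_closed gz_def ext_group_simps(1) in_E(3) prod.collapse)
qed

lemma card_pairings_commutator:
  assumes xy: "x \<in> carrier G" "y \<in> carrier G"
    and a: "a = x \<otimes> y \<otimes> inv x \<otimes> inv y"
    and der: "derived G (carrier G) \<subseteq> range (\<lambda>i::nat. a [^] i)"
  shows "card pairings \<le> G.ord a ^ 2"
proof -
  let ?R = "{w :: complex. w ^ G.ord a = 1}"
  have R: "finite ?R" "card ?R \<le> G.ord a"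
    using ord_pos by (simp_all add: finite_roots_unity card_roots_unity)
  have "card pairings \<le> card (?R \<times> ?R)"
  proof (rule card_inj_on_le)
    show "inj_on (\<lambda>h. (h x, h y)) pairings"
    proof (rule inj_onI)
      fix h k assume hk: "h \<in> pairings" "k \<in> pairings" "(h x, h y) = (k x, k y)"
      then obtain f g where fg: "cocycle G f" "h = (\<lambda>x\<in>carrier G. commutator_pairing f x a)"
        "cocycle G g" "k = (\<lambda>x\<in>carrier G. commutator_pairing g x a)" by (auto simp: pairings_def)
      \<comment> \<open>The pairing of a quotient of cocycles is the quotient of the pairings, so
        agreement at \<open>x\<close> and \<open>y\<close> reduces to a pairing trivial at
        both.\<close>
      let ?f = "\<lambda>x y. f x y / g x y"
      have "commutator_pairing ?f z a = 1" if "z \<in> carrier G" for z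
      proof (rule pairing_trivial[OF _ xy a der _ _ that])
        show "cocycle G ?f" by (rule cocycle_divide[OF G.is_group fg(1,3)])
        show "commutator_pairing ?f x a = 1" "commutator_pairing ?f y a = 1"
          using hk(3) xy pairing_nonzero[OF fg(3)] by (simp_all add: commutator_pairing_divide fg(2,4))
      qed
      then show "h = k"
        using pairing_nonzero[OF fg(3)] by (auto simp: fg(2,4) fun_eq_iff commutator_pairing_divide)
    qed
    show "(\<lambda>h. (h x, h y)) ` pairings \<subseteq> ?R \<times> ?R"
      using xy by (auto simp: pairings_def pairing_pow_ord)
    show "finite (?R \<times> ?R)" using R(1) by simp
  qed
  also have "\<dots> = card ?R * card ?R" by (simp add: card_cartesian_product)
  also have "\<dots> \<le> G.ord a ^ 2" unfolding power2_eq_square using R(2) by (intro mult_mono) auto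
  finally show ?thesis .
qed

text \<open>An injection of pairs (class of \<open>G\<close>, index below \<open>r\<close>) into
  pairs (pairing, class of \<open>Q\<close>). The number \<open>r\<close> counts known classes of
  \<open>Q\<close> with trivial inflation: one trivial class in general, \<open>ord a\<close> many
  when transgression applies.\<close>

lemma card_schur_multiplier_mult_le:
  fixes z :: "nat \<Rightarrow> 'b \<Rightarrow> 'b \<Rightarrow> complex"
  assumes fin: "finite (carrier (schur_multiplier Q))"
    and r: "r > 0"
    and z: "\<And>i. cocycle Q (z i)" "\<And>i. cohomologous G (\<lambda>x y. z i (\<pi> x) (\<pi> y)) (\<lambda>x y. 1)"
      "\<And>i j. i < r \<Longrightarrow> j < r \<Longrightarrow> cohomologous Q (z i) (z j) \<Longrightarrow> i = j"
  shows "finite (carrier (schur_multiplier G)) \<and>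
    card (carrier (schur_multiplier G)) * r \<le> card pairings * card (carrier (schur_multiplier Q))"
proof -
  note Gg = G.is_group and Qg = H.is_group
  let ?M = "carrier (schur_multiplier G)" and ?N = "carrier (schur_multiplier Q)"
  define P where "P f = (\<lambda>x\<in>carrier G. commutator_pairing f x a)" for f
  have "\<forall>C\<in>?M. \<exists>f. cocycle G f \<and> C = schur_class G f"
    by (auto simp: carrier_schur_multiplier[OF Gg])
  then obtain rep where rep: "\<And>C. C \<in> ?M \<Longrightarrow> cocycle G (rep C)" "\<And>C. C \<in> ?M \<Longrightarrow> schur_class G (rep C) = C"
    by metis
  have "\<forall>h\<in>pairings. \<exists>f. cocycle G f \<and> P f = h" by (auto simp: pairings_def P_def)
  then obtain base where base: "\<And>h. h \<in> pairings \<Longrightarrow> cocycle G (base h)" "\<And>h. h \<in> pairings \<Longrightarrow> P (base h) = h"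
    by metis
  have Pin: "P (rep C) \<in> pairings" if "C \<in> ?M" for C using rep(1)[OF that] by (auto simp: pairings_def P_def)
  \<comment> \<open>Dividing by a fixed cocycle with the same pairing leaves a trivial pairing, so
    \<open>d C\<close> is inflated from some \<open>w C\<close>. Multiplying \<open>w C\<close> by
    \<open>z i\<close> changes the class in \<open>Q\<close> but not its inflation.\<close>
  define d where "d C x y = rep C x y / base (P (rep C)) x y" for C x y
  have d: "cocycle G (d C)" if "C \<in> ?M" for C
    unfolding d_def using Gg rep(1)[OF that] base(1)[OF Pin[OF that]] by (rule cocycle_divide)
  have "\<exists>w. cocycle Q w \<and> cohomologous G (\<lambda>x y. w (\<pi> x) (\<pi> y)) (d C)" if C: "C \<in> ?M" for C
  proof (rule cohomologous_inflation[OF d[OF C]])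
    fix x assume x: "x \<in> carrier G"
    have "P (base (P (rep C))) x = P (rep C) x" using base(2)[OF Pin[OF C]] by simp
    then have "commutator_pairing (base (P (rep C))) x a = commutator_pairing (rep C) x a"
      using x by (simp add: P_def)
    moreover have "commutator_pairing (d C) x a =
        commutator_pairing (rep C) x a / commutator_pairing (base (P (rep C))) x a"
      by (simp add: d_def commutator_pairing_def)
    ultimately show "commutator_pairing (d C) x a = 1"
      using pairing_nonzero[OF rep(1)[OF C] x] by simp
  qed blast
  then obtain w where w: "\<And>C. C \<in> ?M \<Longrightarrow> cocycle Q (w C)"
    "\<And>C. C \<in> ?M \<Longrightarrow> cohomologous G (\<lambda>x y. w C (\<pi> x) (\<pi> y)) (d C)" by metis
  define k where "k C i u v = z i u v * w C u v" for C i u v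
  have k: "cocycle Q (k C i)" if "C \<in> ?M" for C i
    unfolding k_def using z(1) w(1)[OF that] by (rule cocycle_mult)
  have infl: "cohomologous G (\<lambda>x y. k C i (\<pi> x) (\<pi> y)) (d C)" if "C \<in> ?M" for C i
    using cohomologous_mult[OF z(2)[of i] w(2)[OF that]] by (simp add: k_def)
  define \<Phi> where "\<Phi> = (\<lambda>(C, i). (P (rep C), schur_class Q (k C i)))"
  have inj: "inj_on \<Phi> (?M \<times> {..<r})"
  proof (rule inj_onI, clarify)
    fix C i D j assume C: "C \<in> ?M" and D: "D \<in> ?M" and ij: "i < r" "j < r" and eq: "\<Phi> (C, i) = \<Phi> (D, j)"
    then have PP: "P (rep C) = P (rep D)" and "schur_class Q (k C i) = schur_class Q (k D j)"
      by (simp_all add: \<Phi>_def)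
    then have kk: "cohomologous Q (k C i) (k D j)"
      using schur_class_eq_iff[OF Qg k[OF C] k[OF D]] by simp
    have dd: "cohomologous G (d C) (d D)"
      using cohomologous_trans[OF cohomologous_sym[OF Gg infl[OF C]] cohomologous_trans[OF cohomologous_inflate[OF kk] infl[OF D]]] .
    \<comment> \<open>Equal pairings mean that \<open>C\<close> and \<open>D\<close> were divided by
      the same base cocycle, so equality of classes passes from \<open>d\<close> back to
      \<open>rep\<close>. Once C = D is known, cancelling \<open>w C\<close> recovers the
      index.\<close>
    let ?b = "base (P (rep C))"
    have b: "cohomologous G (rep E) (\<lambda>x y. d E x y * ?b x y)" if "E = C \<or> E = D" for E
      by (rule cohomologousI[where g = "\<lambda>_. 1"])
        (use that PP cocycle_nonzero[OF base(1)[OF Pin[OF C]]] in \<open>auto simp: d_def\<close>)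
    have "cohomologous G (rep C) (rep D)"
      using cohomologous_trans[OF b[of C] cohomologous_trans[OF cohomologous_mult[OF dd cohomologous_refl] cohomologous_sym[OF Gg b[of D]]]]
      by simp
    then have CD: "C = D" using schur_class_eq_iff[OF Gg rep(1)[OF C] rep(1)[OF D]] rep(2) C D by simp
    have zk: "cohomologous Q (z n) (\<lambda>u v. k C n u v * inverse (w C u v))"
      "cohomologous Q (\<lambda>u v. k C n u v * inverse (w C u v)) (z n)" for n
      by (rule cohomologousI[where g = "\<lambda>_. 1"]; use cocycle_nonzero[OF w(1)[OF C]] in \<open>auto simp: k_def\<close>)+
    have "cohomologous Q (z i) (z j)"
      by (rule cohomologous_trans[OF zk(1) cohomologous_trans[OF cohomologous_mult[OF kk[folded CD] cohomologous_refl] zk(2)]])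
    then show "C = D \<and> i = j" using z(3) ij CD by blast
  qed
  have im: "\<Phi> ` (?M \<times> {..<r}) \<subseteq> pairings \<times> ?N"
    using Pin k by (auto simp: \<Phi>_def carrier_schur_multiplier[OF Qg])
  have finPN: "finite (pairings \<times> ?N)" using finite_pairings fin by simp
  have "finite (?M \<times> {..<r})"
    using inj im finPN by (rule inj_on_finite)
  moreover have "{..<r} \<noteq> {}" using r by auto
  ultimately have "finite ?M" by (rule finite_cartesian_productD1)
  moreover have "card (?M \<times> {..<r}) \<le> card (pairings \<times> ?N)"
    using inj im finPN by (rule card_inj_on_le)
  ultimately show ?thesis by (simp add: card_cartesian_product)
qed

lemma card_schur_multiplier_le:
  assumes "finite (carrier (schur_multiplier Q))"
  shows "finite (carrier (schur_multiplier G))"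
    "order (schur_multiplier G) \<le> card pairings * order (schur_multiplier Q)"
proof -
  have "cocycle Q (\<lambda>u v. 1)" by (simp add: cocycle_def)
  then have "finite (carrier (schur_multiplier G)) \<and>
    card (carrier (schur_multiplier G)) * 1 \<le> card pairings * card (carrier (schur_multiplier Q))"
    using assms by (intro card_schur_multiplier_mult_le[where z = "\<lambda>i u v. 1"]) (auto simp: cohomologous_refl)
  then show "finite (carrier (schur_multiplier G))"
    "order (schur_multiplier G) \<le> card pairings * order (schur_multiplier Q)"
    by (simp_all add: order_def)
qed

lemma card_schur_multiplier_derived_le:
  assumes "finite (carrier (schur_multiplier Q))" "a \<in> derived G (carrier G)"
  shows "order (schur_multiplier G) * G.ord a \<le> card pairings * order (schur_multiplier Q)"
  unfolding order_def
  by (rule transgression[OF assms(2)]) (use card_schur_multiplier_mult_le[OF assms(1) ord_pos] in blast)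

end

subsection \<open>Finite \<open>p\<close>-groups\<close>

text \<open>The quotient is realized on a set of coset representatives with transported
  multiplication, so that it keeps the element type of \<open>G\<close>.\<close>

lemma (in group) ex_central_cyclic_quotient:
  assumes fin: "finite (carrier G)" and a: "a \<in> carrier G"
    and central: "\<And>x. x \<in> carrier G \<Longrightarrow> x \<otimes> a = a \<otimes> x"
  obtains Q :: "'a monoid" and \<pi> where "central_cyclic_quotient G Q \<pi> a"
proof -
  let ?H = "generate G {a}"
  have pos: "ord a \<noteq> 0" using ord_ge_1[OF fin a] by simp
  have H: "x \<in> ?H \<longleftrightarrow> (\<exists>i::nat. x = a [^] i)" for x
    by (auto simp: generate_pow_nat[OF a pos])
  have sub: "subgroup ?H G" using a by (intro generate_is_subgroup) simp
  have "?H \<lhd> G"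
  proof (rule normal_invI[OF sub])
    fix x h assume x: "x \<in> carrier G" and "h \<in> ?H"
    then obtain i :: nat where h: "h = a [^] i" by (auto simp: H)
    have "a [^] i \<otimes> x = x \<otimes> a [^] i"
      using group_commutes_pow[of a x i] a x central by simp
    then have "x \<otimes> h \<otimes> inv x = h \<otimes> x \<otimes> inv x" by (simp only: h)
    also have "\<dots> = h" using a x by (simp add: h m_assoc)
    finally have "x \<otimes> h \<otimes> inv x = h" .
    then show "x \<otimes> h \<otimes> inv x \<in> ?H" using \<open>h \<in> ?H\<close> by simp
  qed
  \<comment> \<open>A representative depending only on the coset of \<open>x\<close>; hence
    \<open>f\<close> identifies exactly the elements of one coset.\<close>
  define f where "f x = (SOME y. y \<in> ?H #> x)" for x
  have f: "f x \<in> ?H #> x" if "x \<in> carrier G" for x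
    unfolding f_def using rcos_self[OF that sub] by (rule someI)
  have coset: "x \<otimes> inv y \<in> ?H \<longleftrightarrow> ?H #> x = ?H #> y" if "x \<in> carrier G" "y \<in> carrier G" for x y
    using subgroup.rcos_module[OF sub is_group that(2,1)] repr_independence[OF _ that(2) sub, of x]
      rcos_self[OF that(1) sub] by blast
  have wgm: "weak_group_morphism f ?H G"
  proof (rule weak_group_morphismsI[OF \<open>?H \<lhd> G\<close>])
    fix x y assume xy: "x \<in> carrier G" "y \<in> carrier G"
    have "f x = f y \<longleftrightarrow> ?H #> x = ?H #> y"
    proof
      assume "f x = f y"
      then have "f x \<in> ?H #> x" "f x \<in> ?H #> y" using f[OF xy(1)] f[OF xy(2)] by simp_all
      then show "?H #> x = ?H #> y"
        using repr_independence[OF _ xy(1) sub] repr_independence[OF _ xy(2) sub] by metis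
    qed (simp add: f_def)
    then show "f x = f y \<longleftrightarrow> x \<otimes> inv y \<in> ?H" using coset[OF xy] by simp
  qed
  interpret Q: group "image_group f G" by (rule image_group_is_group[OF wgm])
  have ker: "kernel G (image_group f G) f = ?H" by (rule weak_group_morphism_ker[OF wgm])
  have "central_cyclic_quotient G (image_group f G) f a"
  proof unfold_locales
    show "f \<in> hom G (image_group f G)" by (rule weak_group_morphism_is_hom[OF wgm])
    show "f ` carrier G = carrier (image_group f G)" by (simp add: image_group_carrier)
    show "f x = \<one>\<^bsub>image_group f G\<^esub> \<longleftrightarrow> (\<exists>i::nat. x = a [^] i)" if "x \<in> carrier G" for x
      using that ker H[of x] by (auto simp: kernel_def)
  qed (use fin a central in auto)
  then show thesis by (rule that)
qed

text \<open>Class equation inside \<open>N\<close>: without central elements other than \<one>, all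
  conjugacy classes in N - {\<one>} have size a positive power of p, so p divides both card N - 1
  and card N.\<close>

lemma (in group) pgroup_normal_meets_center:
  assumes p: "Factorial_Ring.prime p" and ord: "order G = p ^ n"
    and N: "N \<lhd> G" "N \<noteq> {\<one>}"
  obtains c where "c \<in> N" "c \<noteq> \<one>" "\<And>x. x \<in> carrier G \<Longrightarrow> x \<otimes> c = c \<otimes> x"
proof (rule ccontr)
  assume "\<not> thesis"
  with that have no: "\<exists>x\<in>carrier G. x \<otimes> c \<noteq> c \<otimes> x" if "c \<in> N" "c \<noteq> \<one>" for c
    using that by blast
  have p0: "p > 0" using p by (simp add: prime_gt_0_nat)
  have fin: "finite (carrier G)" using ord p0 order_gt_0_iff_finite by simp
  interpret N: normal N G by fact
  define \<phi> where "\<phi> = (\<lambda>g. \<lambda>h \<in> carrier G. g \<otimes> h \<otimes> inv g)"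
  interpret act: group_action G "carrier G" \<phi>
    unfolding \<phi>_def by (rule action_by_conjugation)
  let ?C = "orbit G \<phi> ` (N - {\<one>})"
  have Nsub: "N \<subseteq> carrier G" by (rule N.subset)
  have finN: "finite N" using Nsub fin by (rule finite_subset)
  have orb: "orbit G \<phi> x \<subseteq> N - {\<one>}" if "x \<in> N - {\<one>}" for x
  proof
    fix y assume y: "y \<in> orbit G \<phi> x"
    have xG: "x \<in> carrier G" using that Nsub by blast
    obtain g where g: "g \<in> carrier G" "y = g \<otimes> x \<otimes> inv g"
      using y xG by (auto simp: orbit_def \<phi>_def)
    have "y \<in> N" using N.inv_op_closed2[OF g(1)] that g(2) by auto
    moreover have "y \<noteq> \<one>"
    proof
      assume "y = \<one>"
      then have "g \<otimes> x = g" using g that Nsub inv_solve_right'[of \<one> "g \<otimes> x" g] by auto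
      then show False using g(1) that Nsub by auto
    qed
    ultimately show "y \<in> N - {\<one>}" by simp
  qed
  have "\<Union>?C = N - {\<one>}"
  proof
    show "\<Union>?C \<subseteq> N - {\<one>}" using orb by (rule UN_least)
    show "N - {\<one>} \<subseteq> \<Union>?C"
    proof
      fix x assume x: "x \<in> N - {\<one>}"
      then have "x \<in> carrier G" using Nsub by blast
      then show "x \<in> \<Union>?C" using x act.orbit_refl[of x] by (intro UN_I[OF x])
    qed
  qed
  moreover have "p dvd card (\<Union>?C)"
  proof (rule dvd_partition)
    show "finite (\<Union>?C)" using orb finN by (meson Diff_subset UN_least finite_subset order_trans)
    have orbits: "orbit G \<phi> x \<in> orbits G (carrier G) \<phi>" if "x \<in> N - {\<one>}" for x
      using that Nsub by (auto simp: orbits_def)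
    show "\<forall>c1\<in>?C. \<forall>c2\<in>?C. c1 \<noteq> c2 \<longrightarrow> c1 \<inter> c2 = {}"
    proof (intro ballI impI)
      fix c1 c2 assume "c1 \<in> ?C" "c2 \<in> ?C" and ne: "c1 \<noteq> c2"
      then have "c1 \<in> orbits G (carrier G) \<phi>" "c2 \<in> orbits G (carrier G) \<phi>"
        using orbits by (elim imageE; simp)+
      then show "c1 \<inter> c2 = {}" using act.disjoint_union ne by metis
    qed
    show "\<forall>c\<in>?C. p dvd card c"
    proof
      fix c assume "c \<in> ?C"
      then obtain x where x: "x \<in> N - {\<one>}" "c = orbit G \<phi> x" by blast
      then have xG: "x \<in> carrier G" using Nsub by blast
      have "card c dvd p ^ n" using act.orbit_stabilizer_theorem[OF xG] x(2) ord by (metis dvd_triv_left)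
      then obtain i where i: "card c = p ^ i" using divides_primepow_nat[OF p] by blast
      obtain g where g: "g \<in> carrier G" "g \<otimes> x \<noteq> x \<otimes> g" using no[of x] x(1) by blast
      have "card c \<noteq> 1"
      proof
        assume "card c = 1"
        then obtain u where "c = {u}" by (rule card_1_singletonE)
        moreover have "x \<in> c" using act.orbit_refl[OF xG] x(2) by simp
        moreover have "g \<otimes> x \<otimes> inv g \<in> c" using g(1) xG x(2) by (auto simp: orbit_def \<phi>_def)
        ultimately have "g \<otimes> x \<otimes> inv g = x" by simp
        then show False using g xG inv_solve_right'[of x "g \<otimes> x" g] by simp
      qed
      then have "i \<noteq> 0" using i by auto
      then show "p dvd card c" by (simp add: i)
    qed
  qed
  moreover have "p dvd card N"
  proof -
    have "card N dvd p ^ n" using lagrange[OF N.subgroup_axioms] ord by (metis dvd_triv_right)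
    then obtain i where i: "card N = p ^ i" using divides_primepow_nat[OF p] by blast
    have "card N \<noteq> 1" using N(2) N.one_closed by (metis card_1_singletonE singletonD)
    then have "i \<noteq> 0" using i by auto
    then show ?thesis by (simp add: i)
  qed
  moreover have "card N = Suc (card (N - {\<one>}))"
    using finN N.one_closed by (simp only: card_Suc_Diff1)
  ultimately have "p dvd 1" by (metis Suc_eq_plus1 dvd_add_right_iff)
  then show False using p by (simp add: not_prime_unit)
qed

lemma (in group) pgroup_normal_central_prime_order:
  assumes p: "Factorial_Ring.prime p" and order: "order G = p ^ n"
    and N: "N \<lhd> G" "N \<noteq> {\<one>}"
  obtains c where "c \<in> N" "ord c = p" "\<And>x. x \<in> carrier G \<Longrightarrow> x \<otimes> c = c \<otimes> x"
proof -
  interpret N: normal N G by fact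
  obtain c where c: "c \<in> N" "c \<noteq> \<one>" "\<And>x. x \<in> carrier G \<Longrightarrow> x \<otimes> c = c \<otimes> x"
    by (rule pgroup_normal_meets_center[OF assms]) blast
  have cG: "c \<in> carrier G" using c(1) N.subset by blast
  obtain i where i: "ord c = p ^ i"
    using divides_primepow_nat[OF p] ord_dvd_group_order[OF cG] order by auto
  have "i \<noteq> 0" using i c(2) ord_eq_1[OF cG] by auto
  then obtain j where j: "i = Suc j" using not0_implies_Suc by blast
  have p0: "p \<noteq> 0" using p by auto
  show thesis
  \<comment> \<open>The order of \<open>c\<close> is p^(j+1), so this power has order p and remains
    central and in \<open>N\<close>.\<close>
  proof (rule that[of "c [^] (p ^ j)"])
    have "c [^] (m::nat) \<in> N" for m
      by (induction m) (simp_all add: c(1))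
    then show "c [^] (p ^ j) \<in> N" .
    show "ord (c [^] (p ^ j)) = p"
      using ord_pow[OF cG, of "p ^ j"] p0 by (simp add: i j)
    show "x \<otimes> c [^] (p ^ j) = c [^] (p ^ j) \<otimes> x" if "x \<in> carrier G" for x
      using group_commutes_pow[of c x "p ^ j"] cG that c(3) by simp
  qed
qed

text \<open>By commutativity the product of the cyclic group of \<open>a\<close> and the group
  generated by the rest is already a subgroup.\<close>

lemma (in comm_group) card_generate_le:
  assumes "finite (carrier G)" "finite S" "S \<subseteq> carrier G" "\<And>x. x \<in> S \<Longrightarrow> ord x \<le> e"
  shows "card (generate G S) \<le> e ^ card S"
  using assms(2-4)
proof (induction S)
  case empty
  then show ?case by (simp add: generate_empty)
next
  case (insert a S)
  let ?K = "generate G {a} <#> generate G S"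
  have a: "a \<in> carrier G" and S: "S \<subseteq> carrier G" using insert.prems by auto
  have sub: "subgroup (generate G {a}) G" "subgroup (generate G S) G"
    using a S by (auto intro: generate_is_subgroup)
  have fin: "finite (generate G {a})" "finite (generate G S)"
    using sub assms(1) by (meson finite_subset subgroup.subset)+
  have "insert a S \<subseteq> ?K"
  proof
    fix x assume x: "x \<in> insert a S"
    have "x = x \<otimes> \<one>" "x = \<one> \<otimes> x" using x a S by auto
    moreover have "\<one> \<in> generate G {a}" "\<one> \<in> generate G S" by (rule generate.one)+
    ultimately show "x \<in> ?K"
      using x generate.incl[of x "{a}" G] generate.incl[of x S G] unfolding set_mult_def by blast
  qed
  then have "generate G (insert a S) \<subseteq> ?K"
    by (rule generate_subgroup_incl[OF _ mult_subgroups[OF sub]])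
  moreover have K: "?K = (\<lambda>(x, y). x \<otimes> y) ` (generate G {a} \<times> generate G S)"
    by (auto simp: set_mult_def)
  ultimately have "card (generate G (insert a S)) \<le> card (generate G {a} \<times> generate G S)"
    using surj_card_le[of "generate G {a} \<times> generate G S"] fin by simp
  also have "\<dots> = ord a * card (generate G S)"
    by (simp add: card_cartesian_product generate_pow_card[OF a])
  also have "\<dots> \<le> e * e ^ card S"
    using insert by (intro mult_mono) auto
  finally show ?case using insert by simp
qed

lemma schur_multiplier_trivial:
  assumes "group G" "order G = 1"
  shows "finite (carrier (schur_multiplier G))" "order (schur_multiplier G) \<le> 1"
proof -
  interpret group G by fact
  have "card (carrier G) = 1" using assms(2) by (simp add: order_def)
  then have G: "carrier G = {\<one>\<^bsub>G\<^esub>}" by (metis card_1_singletonE one_closed singletonD)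
  have "schur_class G f = schur_class G (\<lambda>x y. 1)" if f: "cocycle G f" for f
  proof -
    \<comment> \<open>On the trivial group the condition is f(1,1) g(1) = g(1)^2, solved by g(1) =
      f(1,1).\<close>
    have "cohomologous G f (\<lambda>x y. 1)"
      by (rule cohomologousI[where g = "\<lambda>x. f x x"]) (use cocycle_nonzero[OF f] G in auto)
    moreover have "cocycle G (\<lambda>x y. 1)" by (simp add: cocycle_def)
    ultimately show ?thesis using schur_class_eq_iff[OF assms(1) f] by simp
  qed
  then have sub: "carrier (schur_multiplier G) \<subseteq> {schur_class G (\<lambda>x y. 1)}"
    by (auto simp: carrier_schur_multiplier[OF assms(1)])
  then show "finite (carrier (schur_multiplier G))" by (rule finite_subset) simp
  show "order (schur_multiplier G) \<le> 1"
    using card_mono[OF _ sub] by (simp add: order_def)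
qed

section \<open>Orders and generators of the quotient\<close>

context central_cyclic_quotient
begin

text \<open>A subgroup containing \<open>a\<close> is a union of fibres, each parametrized by the
  powers of \<open>a\<close>. It is applied to the whole group and to the commutator
  subgroup.\<close>

lemma card_preimage:
  assumes D: "subgroup D G" and a: "a \<in> D"
  shows "card D = card (\<pi> ` D) * G.ord a"
proof -
  interpret D: subgroup D G by fact
  have pow: "a [^] (i::nat) \<in> D" for i by (induction i) (simp_all add: a)
  have inD: "sec (\<pi> x) \<in> D" if "x \<in> D" for x
  proof -
    have "x \<in> carrier G" using that by (rule D.mem_carrier)
    then obtain i :: nat where "sec (\<pi> x) = x \<otimes> a [^] i"
      using fibre[of x "sec (\<pi> x)"] by (metis \<pi>_sec hom_closed sec_in)
    then show ?thesis using that pow by simp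
  qed
  have "bij_betw (\<lambda>(u, i). sec u \<otimes> a [^] i) (\<pi> ` D \<times> {0..G.ord a - 1}) D"
  proof (rule bij_betw_imageI)
    show "inj_on (\<lambda>(u, i). sec u \<otimes> a [^] i) (\<pi> ` D \<times> {0..G.ord a - 1})"
    proof (rule inj_onI, clarify)
      fix x y and i j :: nat
      assume xy: "x \<in> D" "y \<in> D" and ij: "i \<in> {0..G.ord a - 1}" "j \<in> {0..G.ord a - 1}"
        and eq: "sec (\<pi> x) \<otimes> a [^] i = sec (\<pi> y) \<otimes> a [^] j"
      have "\<pi> (sec (\<pi> x) \<otimes> a [^] i) = \<pi> x" "\<pi> (sec (\<pi> y) \<otimes> a [^] j) = \<pi> y"
        using xy by simp_all
      then have xy': "\<pi> x = \<pi> y" using eq by simp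
      have "a [^] i = a [^] j"
      proof (rule G.l_cancel[of "sec (\<pi> x)"])
        show "sec (\<pi> x) \<otimes> a [^] i = sec (\<pi> x) \<otimes> a [^] j" using eq by (simp only: xy')
      qed (use xy in simp_all)
      then show "\<pi> x = \<pi> y \<and> i = j" using xy' inj_onD[OF G.ord_inj[OF a_in]] ij by blast
    qed
    show "(\<lambda>(u, i). sec u \<otimes> a [^] i) ` (\<pi> ` D \<times> {0..G.ord a - 1}) = D"
    proof (intro equalityI subsetI)
      fix x assume x: "x \<in> D"
      then have xG: "x \<in> carrier G" by simp
      have "a [^] expo x \<in> range (\<lambda>i::nat. a [^] i)" by simp
      also have "\<dots> = {a [^] i | i. i \<in> {0..G.ord a - 1}}"
        unfolding range_pow using G.ord_elems[OF finite_carrier a_in] range_pow by auto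
      finally obtain i where "a [^] expo x = a [^] i" "i \<in> {0..G.ord a - 1}" by blast
      then have "x = sec (\<pi> x) \<otimes> a [^] i" "i \<in> {0..G.ord a - 1}" using expo[OF xG] by simp_all
      then show "x \<in> (\<lambda>(u, i). sec u \<otimes> a [^] i) ` (\<pi> ` D \<times> {0..G.ord a - 1})"
        using x by force
    qed (auto simp: inD pow)
  qed
  from bij_betw_same_card[OF this] show ?thesis
    using ord_pos by (simp add: card_cartesian_product)
qed

lemma order_quotient: "order G = order Q * G.ord a"
  using card_preimage[OF G.subgroup_self a_in] surj by (simp add: order_def)

lemma derived_quotient: "derived Q (carrier Q) = \<pi> ` derived G (carrier G)"
  using derived_img[of "carrier G"] surj by simp

lemma card_derived_quotient:
  assumes "a \<in> derived G (carrier G)"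
  shows "card (derived G (carrier G)) = card (derived Q (carrier Q)) * G.ord a"
  unfolding derived_quotient
  using assms by (intro card_preimage G.derived_is_subgroup) simp_all

lemma generate_quotient:
  assumes "S \<subseteq> carrier G" "generate G S = carrier G"
  shows "generate Q (\<pi> ` S) = carrier Q"
  using generate_img[OF assms(1)] assms(2) surj by simp

end

subsection \<open>The bound\<close>

lemma schur_multiplier_abelian_pgroup:
  fixes G :: "'a monoid"
  assumes p: "Factorial_Ring.prime p" and "comm_group G" "order G = p ^ n"
    and "S \<subseteq> carrier G" "generate G S = carrier G" "card S \<le> d"
  shows "finite (carrier (schur_multiplier G)) \<and>
    real (order (schur_multiplier G)) \<le> real p powr ((real d - 1) * real n / 2)"
  using assms(2-)
proof (induction d arbitrary: G n S)
  have p1: "real p > 1" and p0: "p > 0"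
    using prime_gt_1_nat[OF p] by auto
  \<comment> \<open>With no generators n = 0, which makes the exponent 0 for every d, including d =
    0 where the factor d-1 is negative.\<close>
  have trivial: "finite (carrier (schur_multiplier G)) \<and>
      real (order (schur_multiplier G)) \<le> real p powr ((real d - 1) * real n / 2)"
    if "comm_group G" "order G = p ^ n" "generate G S = carrier G" "S = {}" for d n S and G :: "'a monoid"
  proof -
    interpret comm_group G by fact
    have "order G = 1" using that(3,4) by (simp add: generate_empty order_def flip: that(3))
    then have "n = 0" using that(2) prime_gt_1_nat[OF p] by simp
    then show ?thesis
      using schur_multiplier_trivial[OF is_group \<open>order G = 1\<close>] p0 by simp
  qed
  {
    case 0
    interpret comm_group G by fact
    have "finite (carrier G)" using 0(2) p0 order_gt_0_iff_finite by simp
    then have "S = {}" using 0(3,5) finite_subset by fastforce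
    then show ?case using trivial 0(1,2,4) by blast
  next
    case (Suc d)
    interpret G: comm_group G by fact
    have fin: "finite (carrier G)" using Suc.prems(2) p0 G.order_gt_0_iff_finite by simp
    have finS: "finite S" using Suc.prems(3) fin by (rule finite_subset)
    show ?case
    proof (cases "S = {}")
      case True
      then show ?thesis using trivial Suc.prems(1,2,4) by blast
    next
      case False
      \<comment> \<open>Maximality lets the order of \<open>a\<close> bound those of all the
        generators, which gives \<open>n_le\<close> below.\<close>
      obtain a where a: "a \<in> S" "\<And>x. x \<in> S \<Longrightarrow> G.ord x \<le> G.ord a"
      proof -
        have M: "Max (G.ord ` S) \<in> G.ord ` S" using finS False by (intro Max_in) auto
        then obtain a where "a \<in> S" "G.ord a = Max (G.ord ` S)" by auto
        then show thesis using finS by (intro that[of a]) (auto intro: Max_ge)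
      qed
      have aG: "a \<in> carrier G" using a(1) Suc.prems(3) by blast
      obtain m where m: "G.ord a = p ^ m"
        using divides_primepow_nat[OF p] G.ord_dvd_group_order[OF aG] Suc.prems(2) by auto
      obtain Q :: "'a monoid" and \<pi> where Q: "central_cyclic_quotient G Q \<pi> a"
        using G.ex_central_cyclic_quotient[OF fin aG] G.m_comm[OF _ aG] by blast
      interpret E: central_cyclic_quotient G Q \<pi> a by fact
      let ?T = "\<pi> ` (S - {a})"
      have mn: "m \<le> n"
      proof -
        have "p ^ m dvd p ^ n" using G.ord_dvd_group_order[OF aG] m Suc.prems(2) by simp
        then show ?thesis using prime_gt_1_nat[OF p] by (simp add: dvd_power_iff_le power_dvd_imp_le)
      qed
      have oQ: "order Q = p ^ (n - m)"
      proof -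
        have "order Q * p ^ m = p ^ (n - m) * p ^ m"
          using E.order_quotient m Suc.prems(2) mn by (simp flip: power_add)
        then show ?thesis using p0 by simp
      qed
      have commQ: "comm_group Q"
      proof (rule E.H.group_comm_groupI)
        fix u v assume "u \<in> carrier Q" "v \<in> carrier Q"
        then show "u \<otimes>\<^bsub>Q\<^esub> v = v \<otimes>\<^bsub>Q\<^esub> u"
          using G.m_comm by (auto simp flip: E.surj E.hom_mult)
      qed
      have T: "?T \<subseteq> carrier Q" using Suc.prems(3) by auto
      have "generate Q (\<pi> ` S) \<subseteq> generate Q ?T"
      proof (rule E.H.generate_subgroup_incl[OF _ E.H.generate_is_subgroup[OF T]])
        have "\<pi> a = \<one>\<^bsub>Q\<^esub>" using E.\<pi>_pow[of 1] aG by simp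
        show "\<pi> ` S \<subseteq> generate Q ?T"
        proof (rule image_subsetI)
          fix x assume "x \<in> S"
          then show "\<pi> x \<in> generate Q ?T"
            using \<open>\<pi> a = \<one>\<^bsub>Q\<^esub>\<close> by (cases "x = a") (simp_all add: generate.one generate.incl)
        qed
      qed
      then have genT: "generate Q ?T = carrier Q"
        using E.generate_quotient[OF Suc.prems(3,4)] E.H.generate_incl[OF T] by auto
      have cT: "card ?T \<le> d"
        using card_image_le[of "S - {a}" \<pi>] finS a(1) Suc.prems(5) by simp
      have IH: "finite (carrier (schur_multiplier Q))"
        "real (order (schur_multiplier Q)) \<le> real p powr ((real d - 1) * real (n - m) / 2)"
        using Suc.IH[OF commQ oQ T genT cT] by auto
      have pair: "card E.pairings \<le> p ^ (n - m)"
      proof -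
        have "card E.pairings * p ^ m \<le> p ^ (n - m) * p ^ m"
          using E.card_pairings_order m Suc.prems(2) mn by (simp flip: power_add)
        then show ?thesis using p0 by simp
      qed
      have n_le: "n \<le> Suc d * m"
      proof -
        have "p ^ n \<le> (p ^ m) ^ card S"
          using G.card_generate_le[OF fin finS Suc.prems(3), of "p ^ m"] a(2) m Suc.prems(2,4)
          by (simp add: order_def)
        also have "\<dots> \<le> (p ^ m) ^ Suc d"
          using Suc.prems(5) p0 by (intro power_increasing) auto
        finally have "p ^ n \<le> p ^ (m * Suc d)" by (simp only: power_mult)
        then show ?thesis using power_le_imp_le_exp[OF prime_gt_1_nat[OF p]] by (simp add: mult.commute)
      qed
      have "real (order (schur_multiplier G)) \<le> real (card E.pairings * order (schur_multiplier Q))"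
        using E.card_schur_multiplier_le(2)[OF IH(1)] by (simp only: of_nat_le_iff)
      also have "\<dots> \<le> real p ^ (n - m) * real p powr ((real d - 1) * real (n - m) / 2)"
        unfolding of_nat_mult using pair IH(2) by (intro mult_mono) (simp_all flip: of_nat_power)
      also have "\<dots> = real p powr (real (n - m) + (real d - 1) * real (n - m) / 2)"
        using p0 by (simp add: powr_add powr_realpow)
      also have "\<dots> \<le> real p powr ((real (Suc d) - 1) * real n / 2)"
      proof (rule powr_mono)
        \<comment> \<open>After clearing denominators the goal is (d+1)(n-m) <= d n, which is the
          same as n <= (d+1) m.\<close>
        have "real n \<le> real (Suc d * m)" using n_le by (simp only: of_nat_le_iff)
        then have "real n \<le> (real d + 1) * real m" by (simp add: algebra_simps)
        then show "real (n - m) + (real d - 1) * real (n - m) / 2 \<le> (real (Suc d) - 1) * real n / 2"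
          using mn by (simp add: field_simps of_nat_diff)
      qed (use p1 in simp)
      finally show ?thesis using E.card_schur_multiplier_le(1)[OF IH(1)] by simp
    qed
  }
qed

text \<open>The commutator subgroup has order p^(k+1), so n + k - 1 stands for n + (k+1) - 2. The
  induction starts where that order is p and the quotient is abelian.\<close>

lemma schur_multiplier_nonabelian_pgroup:
  fixes G :: "'a monoid"
  assumes p: "Factorial_Ring.prime p" and "group G" "order G = p ^ n"
    and "card (derived G (carrier G)) = p ^ Suc k"
    and "S \<subseteq> carrier G" "generate G S = carrier G" "card S \<le> d"
  shows "finite (carrier (schur_multiplier G)) \<and>
    real (order (schur_multiplier G)) \<le> real p powr ((real d - 1) * (real n + real k - 1) / 2 + 1)"
  using assms(2-)
proof (induction k arbitrary: G n S)
  have p1: "real p > 1" and p0: "p > 0"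
    using prime_gt_1_nat[OF p] by auto
  have oQ: "n \<noteq> 0 \<and> order Q = p ^ (n - 1)" if "p ^ n = order Q * p" for n and Q :: "'a monoid"
  proof -
    have "n \<noteq> 0"
      using that prime_gt_1_nat[OF p] by (metis dvd_triv_right not_prime_unit p power_0)
    then show ?thesis using that p0 by (cases n) auto
  qed
  {
    case 0
    interpret G: group G by fact
    let ?D = "derived G (carrier G)"
    have fin: "finite (carrier G)" using 0(2) p0 G.order_gt_0_iff_finite by simp
    have DG: "?D \<subseteq> carrier G" by (rule G.derived_in_carrier) simp
    have finD: "finite ?D" using DG fin by (rule finite_subset)
    have subD: "subgroup ?D G" by (rule G.derived_is_subgroup) simp
    have cD: "card ?D = p" using 0(3) by simp
    have ne: "?D \<noteq> {\<one>\<^bsub>G\<^esub>}" using cD p1 by auto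
    have nD: "?D \<lhd> G"
      by (rule G.derived_is_normal) (rule G.normal_self)
    obtain c where c: "c \<in> ?D" "G.ord c = p" "\<And>x. x \<in> carrier G \<Longrightarrow> x \<otimes>\<^bsub>G\<^esub> c = c \<otimes>\<^bsub>G\<^esub> x"
      by (rule G.pgroup_normal_central_prime_order[OF p 0(2) nD ne]) blast
    have cG: "c \<in> carrier G" using c(1) DG by blast
    have gen_D: "generate G {b} = ?D" if "b \<in> ?D" "G.ord b = p" for b
    proof (rule card_subset_eq[OF finD])
      show "generate G {b} \<subseteq> ?D" using that subD by (intro G.generate_subgroup_incl) auto
      show "card (generate G {b}) = card ?D"
        using G.generate_pow_card[of b] that DG cD by auto
    qed
    \<comment> \<open>A group of prime order is generated by its nontrivial central element
      \<open>c\<close>, so the whole commutator subgroup is central.\<close>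
    have central: "x \<otimes>\<^bsub>G\<^esub> b = b \<otimes>\<^bsub>G\<^esub> x" if x: "x \<in> carrier G" and b: "b \<in> ?D" for x b
    proof -
      have "b \<in> generate G {c}" using gen_D[OF c(1,2)] b by simp
      then obtain i :: nat where "b = c [^]\<^bsub>G\<^esub> i"
        using G.generate_pow_nat[OF cG] c(2) p0 by auto
      then show ?thesis using G.group_commutes_pow[of c x i] c(3)[OF x] x cG by simp
    qed
    \<comment> \<open>\<open>c\<close> need not be a commutator, while
      \<open>card_pairings_commutator\<close> asks for one; some commutator is nontrivial, and it
      generates the same subgroup.\<close>
    obtain x y where xy: "x \<in> carrier G" "y \<in> carrier G"
      "x \<otimes>\<^bsub>G\<^esub> y \<otimes>\<^bsub>G\<^esub> inv\<^bsub>G\<^esub> x \<otimes>\<^bsub>G\<^esub> inv\<^bsub>G\<^esub> y \<noteq> \<one>\<^bsub>G\<^esub>"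
    proof -
      have "\<not> derived_set G (carrier G) \<subseteq> {\<one>\<^bsub>G\<^esub>}"
      proof
        assume "derived_set G (carrier G) \<subseteq> {\<one>\<^bsub>G\<^esub>}"
        then have "?D \<subseteq> {\<one>\<^bsub>G\<^esub>}"
          unfolding derived_def by (rule G.generate_subgroup_incl[OF _ G.triv_subgroup])
        then show False using ne subgroup.one_closed[OF subD] by auto
      qed
      then show thesis using that by blast
    qed
    define a where "a = x \<otimes>\<^bsub>G\<^esub> y \<otimes>\<^bsub>G\<^esub> inv\<^bsub>G\<^esub> x \<otimes>\<^bsub>G\<^esub> inv\<^bsub>G\<^esub> y"
    have aD: "a \<in> ?D" unfolding derived_def a_def using xy(1,2) by (intro generate.incl) blast
    have aG: "a \<in> carrier G" using aD DG by blast
    have ord_a: "G.ord a = p"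
    proof -
      have "a \<in> generate G {c}" using gen_D[OF c(1,2)] aD by simp
      then obtain i :: nat where i: "a = c [^]\<^bsub>G\<^esub> i"
        using G.generate_pow_nat[OF cG] c(2) p0 by auto
      have "a [^]\<^bsub>G\<^esub> p = (c [^]\<^bsub>G\<^esub> p) [^]\<^bsub>G\<^esub> i"
        using cG by (simp add: i G.nat_pow_pow mult.commute)
      also have "\<dots> = \<one>\<^bsub>G\<^esub>" using G.pow_ord_eq_1[OF cG] c(2) by simp
      finally have "G.ord a dvd p" using G.pow_eq_id[OF aG] by simp
      then show ?thesis using p G.ord_eq_1[OF aG] xy(3) by (auto simp: prime_nat_iff a_def)
    qed
    obtain Q :: "'a monoid" and \<pi> where Q: "central_cyclic_quotient G Q \<pi> a"
      using G.ex_central_cyclic_quotient[OF fin aG] central[OF _ aD] by blast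
    interpret E: central_cyclic_quotient G Q \<pi> a by fact
    have rD: "?D \<subseteq> range (\<lambda>i::nat. a [^]\<^bsub>G\<^esub> i)"
      unfolding E.range_pow using gen_D[OF aD ord_a] by simp
    have n: "n \<noteq> 0" "order Q = p ^ (n - 1)"
      using oQ[of n Q] E.order_quotient 0(2) ord_a by auto
    have commQ: "comm_group Q"
    proof (rule E.H.group_comm_groupI)
      fix u v assume uv: "u \<in> carrier Q" "v \<in> carrier Q"
      have "u \<otimes>\<^bsub>Q\<^esub> v \<otimes>\<^bsub>Q\<^esub> inv\<^bsub>Q\<^esub> u \<otimes>\<^bsub>Q\<^esub> inv\<^bsub>Q\<^esub> v \<in> derived_set Q (carrier Q)"
        using uv by blast
      also have "\<dots> \<subseteq> derived Q (carrier Q)" unfolding derived_def by (auto intro: generate.incl)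
      also have "\<dots> = \<pi> ` ?D" by (rule E.derived_quotient)
      also have "\<dots> \<subseteq> {\<one>\<^bsub>Q\<^esub>}" using rD by auto
      finally have "u \<otimes>\<^bsub>Q\<^esub> v \<otimes>\<^bsub>Q\<^esub> inv\<^bsub>Q\<^esub> (v \<otimes>\<^bsub>Q\<^esub> u) = \<one>\<^bsub>Q\<^esub>"
        using uv by (simp add: E.H.inv_mult_group E.H.m_assoc)
      then show "u \<otimes>\<^bsub>Q\<^esub> v = v \<otimes>\<^bsub>Q\<^esub> u"
        using uv by (metis E.H.inv_closed E.H.inv_equality E.H.inv_inv E.H.m_closed)
    qed
    have finS: "finite S" using 0(4) fin by (rule finite_subset)
    have T: "\<pi> ` S \<subseteq> carrier Q" "generate Q (\<pi> ` S) = carrier Q" "card (\<pi> ` S) \<le> d"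
      using 0(4) E.generate_quotient[OF 0(4,5)] card_image_le[OF finS, of \<pi>] 0(6) by auto
    have IH: "finite (carrier (schur_multiplier Q))"
      "real (order (schur_multiplier Q)) \<le> real p powr ((real d - 1) * real (n - 1) / 2)"
      using schur_multiplier_abelian_pgroup[OF p commQ n(2) T] by auto
    \<comment> \<open>At most p^2 pairings against a gain of p: the net factor p is the summand 1 in
      the exponent.\<close>
    have "order (schur_multiplier G) * p \<le> p ^ 2 * order (schur_multiplier Q)"
      using E.card_schur_multiplier_derived_le[OF IH(1) aD]
        mult_right_mono[OF E.card_pairings_commutator[OF xy(1,2) a_def rD]] ord_a
      by (metis le_trans le0)
    then have "order (schur_multiplier G) \<le> p * order (schur_multiplier Q)"
      using p0 by (simp add: power2_eq_square)
    then have "real (order (schur_multiplier G)) \<le> real p * real (order (schur_multiplier Q))"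
      by (simp flip: of_nat_mult)
    also have "\<dots> \<le> real p * real p powr ((real d - 1) * real (n - 1) / 2)"
      using IH(2) by (intro mult_left_mono) auto
    also have "\<dots> = real p powr ((real d - 1) * (real n + real 0 - 1) / 2 + 1)"
      using n(1) p0 by (simp add: powr_add of_nat_diff)
    finally show ?case using E.card_schur_multiplier_le(1)[OF IH(1)] by simp
  next
    case (Suc k)
    interpret G: group G by fact
    let ?D = "derived G (carrier G)"
    have fin: "finite (carrier G)" using Suc.prems(2) p0 G.order_gt_0_iff_finite by simp
    have DG: "?D \<subseteq> carrier G" by (rule G.derived_in_carrier) simp
    have ne: "?D \<noteq> {\<one>\<^bsub>G\<^esub>}"
    proof
      assume "?D = {\<one>\<^bsub>G\<^esub>}"
      then have "p ^ Suc (Suc k) = 1" using Suc.prems(3) by simp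
      then show False using prime_gt_1_nat[OF p] by simp
    qed
    have nD: "?D \<lhd> G"
      by (rule G.derived_is_normal) (rule G.normal_self)
    obtain a where a: "a \<in> ?D" "G.ord a = p" "\<And>x. x \<in> carrier G \<Longrightarrow> x \<otimes>\<^bsub>G\<^esub> a = a \<otimes>\<^bsub>G\<^esub> x"
      by (rule G.pgroup_normal_central_prime_order[OF p Suc.prems(2) nD ne]) blast
    have aG: "a \<in> carrier G" using a(1) DG by blast
    obtain Q :: "'a monoid" and \<pi> where Q: "central_cyclic_quotient G Q \<pi> a"
      using G.ex_central_cyclic_quotient[OF fin aG] a(3) by blast
    interpret E: central_cyclic_quotient G Q \<pi> a by fact
    have n: "n \<noteq> 0" "order Q = p ^ (n - 1)"
      using oQ[of n Q] E.order_quotient Suc.prems(2) a(2) by auto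
    have dQ: "card (derived Q (carrier Q)) = p ^ Suc k"
    proof -
      have "card (derived Q (carrier Q)) * p = p ^ Suc (Suc k)"
        using E.card_derived_quotient[OF a(1)] Suc.prems(3) a(2) by metis
      also have "\<dots> = p ^ Suc k * p" by simp
      finally show ?thesis using p0 by (simp only: mult_cancel2) simp
    qed
    have finS: "finite S" using Suc.prems(4) fin by (rule finite_subset)
    have T: "\<pi> ` S \<subseteq> carrier Q" "generate Q (\<pi> ` S) = carrier Q" "card (\<pi> ` S) \<le> d"
      using Suc.prems(4) E.generate_quotient[OF Suc.prems(4,5)] card_image_le[OF finS, of \<pi>] Suc.prems(6) by auto
    have IH: "finite (carrier (schur_multiplier Q))"
      "real (order (schur_multiplier Q)) \<le> real p powr ((real d - 1) * (real (n - 1) + real k - 1) / 2 + 1)"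
      using Suc.IH[OF E.H.is_group n(2) dQ T] by auto
    have "card E.pairings \<le> p ^ card S"
      using E.card_pairings_generators[OF Suc.prems(4,5)] a(2) by simp
    also have "\<dots> \<le> p ^ d" using Suc.prems(6) p0 by (intro power_increasing) auto
    finally have "order (schur_multiplier G) * p \<le> p ^ d * order (schur_multiplier Q)"
      using E.card_schur_multiplier_derived_le[OF IH(1) a(1)] a(2)
      by (metis le_trans mult_le_mono1)
    then have "real (order (schur_multiplier G)) * real p \<le> real p ^ d * real (order (schur_multiplier Q))"
      by (metis of_nat_le_iff of_nat_mult of_nat_power)
    also have "\<dots> \<le> real p ^ d * real p powr ((real d - 1) * (real (n - 1) + real k - 1) / 2 + 1)"
      using IH(2) by (intro mult_left_mono) auto
    also have "\<dots> = real p powr (real d + ((real d - 1) * (real (n - 1) + real k - 1) / 2 + 1))"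
      using p0 by (simp add: powr_add powr_realpow)
    also have "\<dots> = real p powr ((real d - 1) * (real n + real (Suc k) - 1) / 2 + 1 + 1)"
    proof -
      \<comment> \<open>From (n-1, k) to (n, k+1) in the shifted indexing, the main term grows by
        d-1; the additional 1 is the factor p still to be cancelled. That n is positive matters for
        the truncated \<open>n - 1\<close>.\<close>
      have "real d + ((real d - 1) * (real (n - 1) + real k - 1) / 2 + 1) =
          (real d - 1) * (real n + real (Suc k) - 1) / 2 + 1 + 1"
        using n(1) by (simp add: of_nat_diff field_simps)
      then show ?thesis by (simp only:)
    qed
    also have "\<dots> = real p powr ((real d - 1) * (real n + real (Suc k) - 1) / 2 + 1) * real p"
      using p0 by (subst powr_add) simp
    finally show ?case
      using E.card_schur_multiplier_le(1)[OF IH(1)] p0 by simp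
  }
qed

theorem theorem1p1:
  fixes G :: "('a, 'c) monoid_scheme" and p n k d :: nat
  assumes "Factorial_Ring.prime p"
    and "group G"
    and "\<not> comm_group G"
    and "order G = p ^ n"
    and "card (derived G (carrier G)) = p ^ k"
    and "min_generators G = d"
  shows "finite (carrier (schur_multiplier G)) \<and>
         real (order (schur_multiplier G))
           \<le> real p powr (1 / 2 * (real d - 1) * (real n + real k - 2) + 1)"
proof -
  interpret G: group G by fact
  note p = assms(1)
  have p0: "p > 0" using p by (simp add: prime_gt_0_nat)
  have fin: "finite (carrier G)" using assms(4) p0 G.order_gt_0_iff_finite by simp
  have "\<exists>m S. S \<subseteq> carrier G \<and> finite S \<and> card S = m \<and> generate G S = carrier G"
    using fin G.generate_incl[of "carrier G"] generate.incl[of _ "carrier G" G] by blast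
  then have "\<exists>S. S \<subseteq> carrier G \<and> finite S \<and> card S = d \<and> generate G S = carrier G"
    unfolding assms(6)[symmetric] min_generators_def by (rule LeastI_ex)
  then obtain S where S: "S \<subseteq> carrier G" "finite S" "card S = d" "generate G S = carrier G" by blast
  have "k \<noteq> 0"
  proof
    assume "k = 0"
    then obtain u where u: "derived G (carrier G) = {u}" using assms(5) by (auto simp: card_1_singleton_iff)
    have "comm_group G"
    proof (rule G.group_comm_groupI)
      fix x y assume xy: "x \<in> carrier G" "y \<in> carrier G"
      have "x \<otimes>\<^bsub>G\<^esub> y \<otimes>\<^bsub>G\<^esub> inv\<^bsub>G\<^esub> x \<otimes>\<^bsub>G\<^esub> inv\<^bsub>G\<^esub> y \<in> derived G (carrier G)"
        unfolding derived_def using xy by (intro generate.incl) blast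
      moreover have "\<one>\<^bsub>G\<^esub> \<in> derived G (carrier G)"
        unfolding derived_def by (rule generate.one)
      ultimately have "x \<otimes>\<^bsub>G\<^esub> y \<otimes>\<^bsub>G\<^esub> inv\<^bsub>G\<^esub> (y \<otimes>\<^bsub>G\<^esub> x) = \<one>\<^bsub>G\<^esub>"
        using u xy by (simp add: G.inv_mult_group G.m_assoc)
      then show "x \<otimes>\<^bsub>G\<^esub> y = y \<otimes>\<^bsub>G\<^esub> x"
        using xy by (metis G.inv_closed G.inv_equality G.inv_inv G.m_closed)
    qed
    then show False using assms(3) by blast
  qed
  then obtain k' where k': "k = Suc k'" using not0_implies_Suc by blast
  txt \<open>The quotient by the trivial subgroup replaces \<open>G\<close> by an isomorphic copy whose record type
    is closed under the quotient construction of the induction.\<close>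
  obtain Q :: "'a monoid" and \<pi> where "central_cyclic_quotient G Q \<pi> \<one>\<^bsub>G\<^esub>"
    by (rule G.ex_central_cyclic_quotient[OF fin G.one_closed]) auto
  then interpret E: central_cyclic_quotient G Q \<pi> "\<one>\<^bsub>G\<^esub>" .
  have oQ: "order Q = p ^ n" using E.order_quotient assms(4) by simp
  have dQ: "card (derived Q (carrier Q)) = p ^ Suc k'"
    using E.card_derived_quotient assms(5) k' by (simp add: derived_def generate.one)
  have T: "\<pi> ` S \<subseteq> carrier Q" "generate Q (\<pi> ` S) = carrier Q" "card (\<pi> ` S) \<le> d"
    using S(1) E.generate_quotient[OF S(1,4)] card_image_le[OF S(2), of \<pi>] S(3) by auto
  have Q: "finite (carrier (schur_multiplier Q))"
    "real (order (schur_multiplier Q)) \<le> real p powr ((real d - 1) * (real n + real k' - 1) / 2 + 1)"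
    using schur_multiplier_nonabelian_pgroup[OF p E.H.is_group oQ dQ T] by auto
  \<comment> \<open>The identity has order 1, so the bound by values on generators is 1 ^ card S,
    and passing to the copy \<open>Q\<close> costs no factor.\<close>
  have "card E.pairings \<le> 1" using E.card_pairings_generators[OF S(1,4)] by simp
  then have "card E.pairings * order (schur_multiplier Q) \<le> 1 * order (schur_multiplier Q)"
    by (rule mult_le_mono1)
  then have "order (schur_multiplier G) \<le> order (schur_multiplier Q)"
    using E.card_schur_multiplier_le(2)[OF Q(1)] by linarith
  then have "real (order (schur_multiplier G)) \<le> real p powr ((real d - 1) * (real n + real k' - 1) / 2 + 1)"
    using Q(2) by linarith
  moreover have "(real d - 1) * (real n + real k' - 1) / 2 + 1 = 1 / 2 * (real d - 1) * (real n + real k - 2) + 1"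
    by (simp add: k' algebra_simps)
  ultimately show ?thesis
    using E.card_schur_multiplier_le(1)[OF Q(1)] by simp
qed

end
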